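(* Let $K:\{0,1\}^*\to\mathbb{N}$ be a total computable function on binary strings such that $\sum_{x\in\{0,1\}^*} 2^{-K(x)}\le 1$. Then there exists an oracle machine $M$ with the following property: for every infinite bit sequence $\alpha$ there exists an infinite bit sequence $\beta$ such that $M$ computes $\alpha$ with oracle $\beta$, and for every $n$ the oracle use when computing the prefix $\alpha\upharpoonright n$ is at most $K(\alpha\upharpoonright n)$.
   Context: $\alpha\upharpoonright n$ denotes the prefix of length $n$ of the bit sequence $\alpha$. An oracle machine has an input tape on which an infinite sequence of zeros and ones (the oracle) is written. The machine reads the input tape sequentially, bit by bit, while performing some other computations, and writes an output bit sequence one bit at a time. For a given oracle $\beta$ the output sequence may be finite or infinite; $M$ computes $\alpha$ with oracle $\beta$ if the output sequence is $\alpha$. For a prefix $\alpha\upharpoonright n$ of the output, the oracle use when computing $\alpha\upharpoonright n$ is the number of input (oracle) bits read up to the moment when $n$ output bits have been produced. *)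

theory Defs
  imports "HOL-Analysis.Infinite_Sum"
begin

type_synonym bitseq = "nat \<Rightarrow> bool"

definition restr :: "bitseq \<Rightarrow> nat \<Rightarrow> bool list"  (infixl "\<restriction>" 75)
  where "\<alpha> \<restriction> n = map \<alpha> [0..<n]"

text \<open>
  Oracle machines are register machines controlled by finite while-programs, the registers holding
  natural numbers. The oracle tape is read-only and one-way, the output tape is write-only and
  one-way; \<open>Read\<close> and \<open>Write\<close> transfer exactly one bit, a nonzero register being
  written as one. Without these two instructions the programs compute exactly the partial
  computable functions.
\<close>

datatype instr =
    Inc nat
  | Dec nat
  | While nat "instr list"
  | Read nat
  | Write nat

type_synonym machine = "instr list"

text \<open>
  \<open>control\<close> is the list of instructions that remain to be executed; the machine has halted
  when it is empty. \<open>bits_read\<close> is the position of the head on the oracle tape.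
\<close>

record config =
  control :: "instr list"
  regs :: "nat \<Rightarrow> nat"
  bits_read :: nat
  written :: "bool list"

fun exec :: "bitseq \<Rightarrow> instr \<Rightarrow> config \<Rightarrow> config" where
  "exec \<beta> (Inc r) c = c\<lparr>regs := (regs c)(r := regs c r + 1)\<rparr>"
| "exec \<beta> (Dec r) c = c\<lparr>regs := (regs c)(r := regs c r - 1)\<rparr>"
| "exec \<beta> (While r p) c =
    (if regs c r = 0 then c else c\<lparr>control := p @ While r p # control c\<rparr>)"
| "exec \<beta> (Read r) c =
    c\<lparr>regs := (regs c)(r := of_bool (\<beta> (bits_read c))), bits_read := bits_read c + 1\<rparr>"
| "exec \<beta> (Write r) c = c\<lparr>written := written c @ [regs c r \<noteq> 0]\<rparr>"

definition step :: "bitseq \<Rightarrow> config \<Rightarrow> config" where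
  "step \<beta> c = (case control c of [] \<Rightarrow> c | i # p \<Rightarrow> exec \<beta> i (c\<lparr>control := p\<rparr>))"

definition start :: "machine \<Rightarrow> (nat \<Rightarrow> nat) \<Rightarrow> config" where
  "start M s = \<lparr>control = M, regs = s, bits_read = 0, written = []\<rparr>"

definition run :: "machine \<Rightarrow> bitseq \<Rightarrow> nat \<Rightarrow> config" where
  "run M \<beta> t = (step \<beta> ^^ t) (start M (\<lambda>_. 0))"

definition computes :: "machine \<Rightarrow> bitseq \<Rightarrow> bitseq \<Rightarrow> bool" where
  "computes M \<beta> \<alpha> \<longleftrightarrow>
    (\<forall>t. written (run M \<beta> t) = \<alpha> \<restriction> length (written (run M \<beta> t))) \<and>
    (\<forall>n. \<exists>t. n \<le> length (written (run M \<beta> t)))"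

text \<open>
  Meaningful only if at least \<open>n\<close> output bits are produced eventually, in particular
  whenever the output is infinite.
\<close>

definition oracle_use :: "machine \<Rightarrow> bitseq \<Rightarrow> nat \<Rightarrow> nat" where
  "oracle_use M \<beta> n = bits_read (run M \<beta> (LEAST t. n \<le> length (written (run M \<beta> t))))"

fun io_free :: "instr \<Rightarrow> bool" where
  "io_free (Inc r) = True"
| "io_free (Dec r) = True"
| "io_free (While r p) = (\<forall>i\<in>set p. io_free i)"
| "io_free (Read r) = False"
| "io_free (Write r) = False"

text \<open>The string \<open>x\<close> is represented by the number with binary notation \<open>1x\<close>.\<close>

definition str_code :: "bool list \<Rightarrow> nat" where
  "str_code x = foldl (\<lambda>m b. 2 * m + of_bool b) 1 x"

text \<open>
  A total function is computable if some program without oracle and output instructions halts on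
  every input, with the input and the result in register \<open>0\<close> and the other registers
  initially zero. The oracle in the definition is a dummy, since it is never read.
\<close>

definition total_computable :: "(bool list \<Rightarrow> nat) \<Rightarrow> bool" where
  "total_computable f \<longleftrightarrow> (\<exists>p. (\<forall>i\<in>set p. io_free i) \<and>
    (\<forall>x. \<exists>t. let c = (step (\<lambda>_. False) ^^ t) (start p ((\<lambda>_. 0)(0 := str_code x)))
      in control c = [] \<and> regs c 0 = f x))"

end

theory Submission
  imports Defs "HOL-Library.Nat_Bijection" "HOL-Library.Sublist"
begin

text \<open>
  The idea is to hand out cylinders of oracles online. The strings are processed in the order of
  their codes; at any stage Cantor space is partitioned into cylinders, each labelled with the
  output that its elements are known to produce so far. A new string \<open>x\<close> takes a cylinder of
  length \<open>K x\<close> out of a cylinder labelled by a proper prefix \<open>w\<close> of \<open>x\<close>, namely the longest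
  prefix that has a suitable one, and there the smallest that fits. Each string \<open>v\<close> between
  \<open>w\<close> and \<open>x\<close> thereby gains a whole cylinder of length at most \<open>K v\<close> and keeps what
  is not passed on. Hence cylinders with the same label \<open>v\<close> have different lengths, and their
  total measure is at most \<open>2\<close> to the power \<open>- K v\<close>; if no cylinder were available for
  \<open>x\<close>, the measures would add up to less than the Kraft sum, although the cylinders cover the space.

  The machine simulates this process. Having read \<open>\<sigma>\<close>, it writes a bit once every
  part of the cylinder \<open>\<sigma>\<close> is labelled accordingly, and reads a bit only if the partition
  separates extensions of \<open>\<sigma>\<close>. Since a string \<open>y\<close> only ever gains whole cylinders of
  length at most \<open>K y\<close>, each contained in one cylinder of the partition at that time, the
  machine never reads too much.
\<close>

section \<open>Programs for computable functions\<close>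

text \<open>\<open>K\<close> need not be monotone along prefixes: a string may be cheaper than its
  own prefixes. Once x is placed below a label \<open>w\<close>, the output passes through all
  strings between \<open>w\<close> and x, so the bound of each of them has to be met. That is why a
  piece must be \<open>usable\<close> for the whole path and why its offcuts go to the cheap strings
  on it. The rule of selection protects the invariants: an offcut is itself usable for x, so an
  older piece with the same label and length would have been preferred. The empty string holds the
  whole space from the start. When measure is compared with the Kraft sum, what is left at a proper
  prefix of x is charged to longer prefixes of x, so that no term for the empty string enters the
  count. An oracle for an infinite \<alpha> exists by compactness: each prefix of \<alpha> is
  decided by boundedly many oracle bits. For the machine a stage is a finite set coded by one
  number. It is recomputed in every round, so only the bits read, the output and the round number
  have to be kept.\<close>

definition io :: "config \<Rightarrow> nat \<times> bool list" where
  "io c = (bits_read c, written c)"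

text \<open>Oracle use is measured at a single moment, so it does not suffice to know where a
  computation ends: \<open>X\<close> restricts the pairs of bits read and bits written that may
  occur on the way.\<close>

definition leads :: "bitseq \<Rightarrow> (nat \<times> bool list) set \<Rightarrow> config \<Rightarrow> config \<Rightarrow> bool" where
  "leads \<beta> X c c' \<longleftrightarrow>
    (\<exists>t. (step \<beta> ^^ t) c = c' \<and> (\<forall>t'\<le>t. io ((step \<beta> ^^ t') c) \<in> X))"

lemma leads_refl: "io c \<in> X \<Longrightarrow> leads \<beta> X c c"
  unfolding leads_def by (intro exI[of _ 0]) auto

lemma leads_trans:
  assumes "leads \<beta> X c c'" "leads \<beta> X c' c''"
  shows "leads \<beta> X c c''"
proof -
  obtain t where t: "(step \<beta> ^^ t) c = c'" "\<And>t'. t' \<le> t \<Longrightarrow> io ((step \<beta> ^^ t') c) \<in> X"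
    using assms(1) unfolding leads_def by blast
  obtain u where u: "(step \<beta> ^^ u) c' = c''" "\<And>t'. t' \<le> u \<Longrightarrow> io ((step \<beta> ^^ t') c') \<in> X"
    using assms(2) unfolding leads_def by blast
  have "(step \<beta> ^^ (u + t)) c = c''"
    by (simp add: funpow_add t u)
  moreover have "io ((step \<beta> ^^ t') c) \<in> X" if "t' \<le> u + t" for t'
  proof (cases "t' \<le> t")
    case False
    then have "t' = (t' - t) + t" by simp
    then have "(step \<beta> ^^ t') c = (step \<beta> ^^ (t' - t)) c'"
      by (metis funpow_add comp_apply t(1))
    with False that show ?thesis by (simp add: u(2))
  qed (simp add: t)
  ultimately show ?thesis unfolding leads_def by blast
qed

lemma leads_step: "io c \<in> X \<Longrightarrow> io (step \<beta> c) \<in> X \<Longrightarrow> leads \<beta> X c (step \<beta> c)"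
  unfolding leads_def by (intro exI[of _ 1]) (auto simp: le_Suc_eq)

lemma leads_mono: "leads \<beta> X c c' \<Longrightarrow> X \<subseteq> Y \<Longrightarrow> leads \<beta> Y c c'"
  unfolding leads_def by blast

abbreviation conf :: "machine \<Rightarrow> (nat \<Rightarrow> nat) \<Rightarrow> nat \<Rightarrow> bool list \<Rightarrow> config" where
  "conf p s b w \<equiv> \<lparr>control = p, regs = s, bits_read = b, written = w\<rparr>"

text \<open>The quantified continuation \<open>q\<close> lets fragments compose by append, because
  \<open>control\<close> holds the code still to be executed. The singleton says that both tapes
  stay unchanged throughout.\<close>

definition pure_run :: "machine \<Rightarrow> (nat \<Rightarrow> nat) \<Rightarrow> (nat \<Rightarrow> nat) \<Rightarrow> bool" where
  "pure_run p s s' \<longleftrightarrow>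
    (\<forall>\<beta> q b w. leads \<beta> {(b, w)} (conf (p @ q) s b w) (conf q s' b w))"

lemma pure_run_Nil: "pure_run [] s s"
  by (simp add: pure_run_def leads_refl io_def)

lemma pure_run_append: "pure_run p s s' \<Longrightarrow> pure_run q s' s'' \<Longrightarrow> pure_run (p @ q) s s''"
  unfolding pure_run_def by (metis append.assoc leads_trans)

lemma pure_run_Cons: "pure_run [i] s s' \<Longrightarrow> pure_run q s' s'' \<Longrightarrow> pure_run (i # q) s s''"
  using pure_run_append[of "[i]"] by simp

lemma pure_run_Inc: "pure_run [Inc r] s (s(r := s r + 1))"
  unfolding pure_run_def
proof (intro allI)
  fix \<beta> q b w
  show "leads \<beta> {(b, w)} (conf ([Inc r] @ q) s b w) (conf q (s(r := s r + 1)) b w)"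
    using leads_step[of "conf ([Inc r] @ q) s b w" "{(b, w)}" \<beta>] by (simp add: io_def step_def)
qed

lemma pure_run_Dec: "pure_run [Dec r] s (s(r := s r - 1))"
  unfolding pure_run_def
proof (intro allI)
  fix \<beta> q b w
  show "leads \<beta> {(b, w)} (conf ([Dec r] @ q) s b w) (conf q (s(r := s r - 1)) b w)"
    using leads_step[of "conf ([Dec r] @ q) s b w" "{(b, w)}" \<beta>] by (simp add: io_def step_def)
qed

lemma leads_While_exit: "s r = 0 \<Longrightarrow> leads \<beta> {(b, w)} (conf (While r p # q) s b w) (conf q s b w)"
  using leads_step[of "conf (While r p # q) s b w" "{(b, w)}" \<beta>] by (simp add: io_def step_def)

lemma leads_While_enter: "s r \<noteq> 0 \<Longrightarrow>
    leads \<beta> {(b, w)} (conf (While r p # q) s b w) (conf (p @ While r p # q) s b w)"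
  using leads_step[of "conf (While r p # q) s b w" "{(b, w)}" \<beta>] by (simp add: io_def step_def)

lemma pure_run_While_exit: "s r = 0 \<Longrightarrow> pure_run [While r p] s s"
  unfolding pure_run_def by (simp add: leads_While_exit)

lemma pure_run_While_enter:
  assumes "s r \<noteq> 0" "pure_run p s s'" "pure_run [While r p] s' s''"
  shows "pure_run [While r p] s s''"
  unfolding pure_run_def
proof (intro allI)
  fix \<beta> q b w
  have "leads \<beta> {(b, w)} (conf (p @ While r p # q) s b w) (conf (While r p # q) s' b w)"
    using assms(2) by (simp add: pure_run_def)
  moreover have "leads \<beta> {(b, w)} (conf (While r p # q) s' b w) (conf q s'' b w)"
    using assms(3) by (simp add: pure_run_def)
  ultimately show "leads \<beta> {(b, w)} (conf ([While r p] @ q) s b w) (conf q s'' b w)"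
    using leads_While_enter[of s r \<beta> b w p q] assms(1) by (auto intro: leads_trans)
qed

definition clear :: "nat \<Rightarrow> instr" where "clear r = While r [Dec r]"

lemma pure_run_clear: "pure_run [clear r] s (s(r := 0))"
proof (induction "s r" arbitrary: s)
  case 0
  then show ?case by (metis clear_def fun_upd_triv pure_run_While_exit)
next
  case (Suc k)
  have "pure_run [clear r] (s(r := s r - 1)) (s(r := 0))"
    using Suc(1)[of "s(r := s r - 1)"] Suc(2) by simp
  then show ?case
    unfolding clear_def using Suc(2) pure_run_While_enter[of s r, OF _ pure_run_Dec] by simp
qed

definition move :: "nat \<Rightarrow> nat \<Rightarrow> instr" where "move a b = While a [Dec a, Inc b]"

lemma pure_run_move:
  assumes "a \<noteq> b"
  shows "pure_run [move a b] s (s(b := s b + s a, a := 0))"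
proof (induction "s a" arbitrary: s)
  case 0
  then have "s(b := s b + s a, a := 0) = s" by auto
  with pure_run_While_exit[of s a] 0 show ?case by (simp add: move_def)
next
  case (Suc k)
  let ?s1 = "s(a := s a - 1)"
  let ?s = "?s1(b := ?s1 b + 1)"
  have "?s(b := ?s b + ?s a, a := 0) = s(b := s b + s a, a := 0)"
    using Suc(2) assms by (intro ext) auto
  then have 1: "pure_run [move a b] ?s (s(b := s b + s a, a := 0))"
    using Suc(1)[of ?s] Suc(2) assms by simp
  have 2: "pure_run [Dec a, Inc b] s ?s"
    by (rule pure_run_Cons[OF pure_run_Dec pure_run_Inc])
  show ?case
    using pure_run_While_enter[of s a, OF _ 2 1[unfolded move_def]] Suc(2) by (simp add: move_def)
qed

text \<open>A loop can only consume its register; the helper \<open>h\<close> receives a second copy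
  from which \<open>a\<close> is restored.\<close>

definition copy :: "nat \<Rightarrow> nat \<Rightarrow> nat \<Rightarrow> machine" where
  "copy a b h = [While a [Dec a, Inc b, Inc h], move h a]"

lemma pure_run_copy:
  assumes "a \<noteq> b" "a \<noteq> h" "b \<noteq> h" "s b = 0" "s h = 0"
  shows "pure_run (copy a b h) s (s(b := s a))"
proof -
  have *: "pure_run [While a [Dec a, Inc b, Inc h]] s
      (s(b := s b + s a, h := s h + s a, a := 0))" for s
  proof (induction "s a" arbitrary: s)
    case 0
    then have "s(b := s b + s a, h := s h + s a, a := 0) = s" by auto
    with pure_run_While_exit[of s a] 0 show ?case by simp
  next
    case (Suc k)
    let ?s1 = "s(a := s a - 1)"
    let ?s2 = "?s1(b := ?s1 b + 1)"
    let ?s = "?s2(h := ?s2 h + 1)"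
    have "?s(b := ?s b + ?s a, h := ?s h + ?s a, a := 0)
        = s(b := s b + s a, h := s h + s a, a := 0)"
      using Suc(2) assms by (intro ext) auto
    then have 1: "pure_run [While a [Dec a, Inc b, Inc h]] ?s
        (s(b := s b + s a, h := s h + s a, a := 0))"
      using Suc(1)[of ?s] Suc(2) assms by simp
    have 2: "pure_run [Dec a, Inc b, Inc h] s ?s"
      by (rule pure_run_Cons[OF pure_run_Dec pure_run_Cons[OF pure_run_Inc pure_run_Inc]])
    show ?case
      using pure_run_While_enter[of s a, OF _ 2 1] Suc(2) by simp
  qed
  let ?s = "s(b := s b + s a, h := s h + s a, a := 0)"
  have "?s(a := ?s a + ?s h, h := 0) = s(b := s a)"
    using assms by (intro ext) auto
  moreover have "pure_run [move h a] ?s (?s(a := ?s a + ?s h, h := 0))"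
    using assms by (intro pure_run_move) auto
  ultimately have "pure_run [move h a] ?s (s(b := s a))" by simp
  then show ?thesis unfolding copy_def by (rule pure_run_Cons[OF *])
qed

text \<open>An environment variable \<open>i\<close> is held in register \<open>\<rho> i\<close>; the registers from \<open>d\<close> on
  form a zeroed stack, onto which the program pushes the value. Variables that \<open>\<rho>\<close> places into
  the stack area have the value zero.\<close>

definition computable :: "((nat \<Rightarrow> nat) \<Rightarrow> nat) \<Rightarrow> bool" where
  "computable e \<longleftrightarrow> (\<forall>\<rho> d. \<exists>p. \<forall>s. (\<forall>r\<ge>d. s r = 0) \<longrightarrow>
    pure_run p s (s(d := e (\<lambda>i. s (\<rho> i)))))"

lemma computableE:
  assumes "computable e"
  obtains p where "\<And>s. (\<And>r. r \<ge> d \<Longrightarrow> s r = 0) \<Longrightarrow> pure_run p s (s(d := e (\<lambda>i. s (\<rho> i))))"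
  using assms unfolding computable_def by meson

lemma computable_var: "computable (\<lambda>s. s i)"
  unfolding computable_def
proof (intro allI)
  fix \<rho> d
  show "\<exists>p. \<forall>s. (\<forall>r\<ge>d. s r = 0) \<longrightarrow> pure_run p s (s(d := s (\<rho> i)))"
  proof (cases "\<rho> i < d")
    case True
    then show ?thesis
      by (intro exI[of _ "copy (\<rho> i) d (Suc d)"] allI impI pure_run_copy) auto
  next
    case False
    have "pure_run [] s (s(d := s (\<rho> i)))" if "\<forall>r\<ge>d. s r = 0" for s
    proof -
      have "s(d := s (\<rho> i)) = s" using False that by (intro ext) auto
      then show ?thesis by (simp add: pure_run_Nil)
    qed
    then show ?thesis by blast
  qed
qed

lemma computable_0: "computable (\<lambda>s. 0)"
proof -
  have "pure_run [] s (s(d := 0))" if "\<forall>r\<ge>d. s r = 0" for s :: "nat \<Rightarrow> nat" and d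
    using that by (metis fun_upd_triv order_refl pure_run_Nil)
  then show ?thesis unfolding computable_def by blast
qed

lemma computable_Suc:
  assumes "computable e"
  shows "computable (\<lambda>s. Suc (e s))"
  unfolding computable_def
proof (intro allI)
  fix \<rho> d
  obtain p where p: "\<And>s. (\<And>r. r \<ge> d \<Longrightarrow> s r = 0) \<Longrightarrow> pure_run p s (s(d := e (\<lambda>i. s (\<rho> i))))"
    using computableE[OF assms] by blast
  have "pure_run (p @ [Inc d]) s (s(d := Suc (e (\<lambda>i. s (\<rho> i)))))" if "\<forall>r\<ge>d. s r = 0" for s
    using pure_run_append[OF p pure_run_Inc[of d]] that by simp
  then show "\<exists>p. \<forall>s. (\<forall>r\<ge>d. s r = 0) \<longrightarrow> pure_run p s (s(d := Suc (e (\<lambda>i. s (\<rho> i)))))" by blast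
qed

lemma computable_pred:
  assumes "computable e"
  shows "computable (\<lambda>s. e s - 1)"
  unfolding computable_def
proof (intro allI)
  fix \<rho> d
  obtain p where p: "\<And>s. (\<And>r. r \<ge> d \<Longrightarrow> s r = 0) \<Longrightarrow> pure_run p s (s(d := e (\<lambda>i. s (\<rho> i))))"
    using computableE[OF assms] by blast
  have "pure_run (p @ [Dec d]) s (s(d := e (\<lambda>i. s (\<rho> i)) - 1))" if "\<forall>r\<ge>d. s r = 0" for s
    using pure_run_append[OF p pure_run_Dec[of d]] that by simp
  then show "\<exists>p. \<forall>s. (\<forall>r\<ge>d. s r = 0) \<longrightarrow> pure_run p s (s(d := e (\<lambda>i. s (\<rho> i)) - 1))" by blast
qed

lemma computable_rename: "computable e \<Longrightarrow> computable (\<lambda>s. e (\<lambda>i. s (\<sigma> i)))"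
  unfolding computable_def by meson

text \<open>Environments are read in de Bruijn style: in the body, variable 0 is the index, variable
  1 the accumulator, and outer variables move up by two. The registers from \<open>d\<close> on hold
  the remaining count, the index, the accumulator and the new value.\<close>

lemma computable_rec:
  assumes B: "computable (\<lambda>s. B (s 0) (s (Suc 0)) (\<lambda>i. s (Suc (Suc i))))"
    and a: "computable a" and n: "computable n"
  shows "computable (\<lambda>s. rec_nat (a s) (\<lambda>i acc. B i acc s) (n s))"
  unfolding computable_def
proof (intro allI)
  fix \<rho> d
  let ?r1 = "Suc d" and ?r2 = "Suc (Suc d)" and ?r3 = "Suc (Suc (Suc d))"
  obtain pn where pn: "\<And>s. (\<And>r. r \<ge> d \<Longrightarrow> s r = 0) \<Longrightarrow> pure_run pn s (s(d := n (\<lambda>i. s (\<rho> i))))"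
    using computableE[OF n] by blast
  \<comment> \<open>Variables placed at \<open>d\<close> or above must read as zero although the
    stack is filling up; they are redirected to a register that is still zero when the code runs.
    \<open>\<rho>2\<close> does the same.\<close>
  define \<rho>1 where "\<rho>1 = (\<lambda>i. if \<rho> i < d then \<rho> i else ?r2)"
  obtain pa where pa: "\<And>s. (\<And>r. r \<ge> ?r2 \<Longrightarrow> s r = 0) \<Longrightarrow>
      pure_run pa s (s(?r2 := a (\<lambda>i. s (\<rho>1 i))))"
    using computableE[OF a] by blast
  define \<rho>2 where "\<rho>2 = case_nat ?r1 (case_nat ?r2 (\<lambda>i. if \<rho> i < d then \<rho> i else ?r3))"
  obtain pB where pB: "\<And>s. (\<And>r. r \<ge> ?r3 \<Longrightarrow> s r = 0) \<Longrightarrow>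
      pure_run pB s (s(?r3 := B (s (\<rho>2 0)) (s (\<rho>2 (Suc 0))) (\<lambda>i. s (\<rho>2 (Suc (Suc i))))))"
    using computableE[OF B] by blast
  let ?body = "Dec d # pB @ [clear ?r2, move ?r3 ?r2, Inc ?r1]"
  have "pure_run (pn @ pa @ [While d ?body, clear ?r1, move ?r2 d]) s
      (s(d := rec_nat (a (\<lambda>i. s (\<rho> i))) (\<lambda>i acc. B i acc (\<lambda>i. s (\<rho> i))) (n (\<lambda>i. s (\<rho> i)))))"
    if z: "\<forall>r\<ge>d. s r = 0" for s
  proof -
    let ?e = "\<lambda>i. s (\<rho> i)"
    define R where "R = rec_nat (a ?e) (\<lambda>i acc. B i acc ?e)"
    define st where "st = (\<lambda>k i acc. s(d := k, ?r1 := i, ?r2 := acc))"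
    have 1: "pure_run pn s (s(d := n ?e))"
      using z by (intro pn) auto
    have "(\<lambda>i. (s(d := n ?e)) (\<rho>1 i)) = ?e"
      using z by (auto simp: \<rho>1_def)
    moreover have "s(d := n ?e, ?r2 := a ?e) = st (n ?e) 0 (R 0)"
      using z by (intro ext) (auto simp: st_def R_def)
    ultimately have 2: "pure_run pa (s(d := n ?e)) (st (n ?e) 0 (R 0))"
      using pa[of "s(d := n ?e)"] z by simp
    have body: "pure_run ?body (st (Suc k) i acc) (st k (Suc i) (B i acc ?e))" for k i acc
    proof -
      have "(st (Suc k) i acc)(d := (st (Suc k) i acc) d - 1) = st k i acc"
        by (auto simp: st_def)
      with pure_run_Dec[of d "st (Suc k) i acc"]
      have b1: "pure_run [Dec d] (st (Suc k) i acc) (st k i acc)" by simp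
      have "st k i acc (\<rho>2 0) = i" "st k i acc (\<rho>2 (Suc 0)) = acc"
        "(\<lambda>j. st k i acc (\<rho>2 (Suc (Suc j)))) = ?e"
        using z by (auto simp: st_def \<rho>2_def)
      moreover have "st k i acc r = 0" if "r \<ge> ?r3" for r using that z by (auto simp: st_def)
      ultimately have b2: "pure_run pB (st k i acc) ((st k i acc)(?r3 := B i acc ?e))"
        using pB[of "st k i acc"] by simp
      let ?s3 = "(st k i acc)(?r3 := B i acc ?e, ?r2 := 0)"
      have b3: "pure_run [clear ?r2] ((st k i acc)(?r3 := B i acc ?e)) ?s3"
        by (rule pure_run_clear)
      have "?s3(?r2 := ?s3 ?r2 + ?s3 ?r3, ?r3 := 0) = st k i (B i acc ?e)"
        using z by (intro ext) (auto simp: st_def)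
      with pure_run_move[of ?r3 ?r2 ?s3]
      have b4: "pure_run [move ?r3 ?r2] ?s3 (st k i (B i acc ?e))" by simp
      have "(st k i (B i acc ?e))(?r1 := st k i (B i acc ?e) ?r1 + 1) = st k (Suc i) (B i acc ?e)"
        by (auto simp: st_def)
      with pure_run_Inc[of ?r1 "st k i (B i acc ?e)"]
      have b5: "pure_run [Inc ?r1] (st k i (B i acc ?e)) (st k (Suc i) (B i acc ?e))" by simp
      show ?thesis
        by (rule pure_run_Cons[OF b1 pure_run_append[OF b2 pure_run_Cons[OF b3
            pure_run_Cons[OF b4 b5]]]])
    qed
    have loop: "pure_run [While d ?body] (st k i (R i)) (st 0 (i + k) (R (i + k)))" for k i
    proof (induction k arbitrary: i)
      case 0
      show ?case by (simp add: pure_run_While_exit st_def)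
    next
      case (Suc k)
      have 1: "pure_run ?body (st (Suc k) i (R i)) (st k (Suc i) (R (Suc i)))"
        using body[of k i "R i"] by (simp add: R_def)
      have "st (Suc k) i (R i) d \<noteq> 0" by (simp add: st_def)
      from pure_run_While_enter[OF this 1 Suc[of "Suc i"]] show ?case by simp
    qed
    let ?N = "n ?e"
    let ?s4 = "(st 0 ?N (R ?N))(?r1 := 0)"
    have 4: "pure_run [clear ?r1] (st 0 ?N (R ?N)) ?s4"
      by (rule pure_run_clear)
    have "?s4(d := ?s4 d + ?s4 ?r2, ?r2 := 0) = s(d := R ?N)"
      using z by (intro ext) (auto simp: st_def)
    with pure_run_move[of ?r2 d ?s4] have 5: "pure_run [move ?r2 d] ?s4 (s(d := R ?N))" by simp
    have 3: "pure_run [While d ?body] (st ?N 0 (R 0)) (st 0 ?N (R ?N))"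
      using loop[of ?N 0] by simp
    from pure_run_append[OF 1 pure_run_append[OF 2 pure_run_Cons[OF 3 pure_run_Cons[OF 4 5]]]]
    show ?thesis by (simp add: R_def)
  qed
  then show "\<exists>p. \<forall>s. (\<forall>r\<ge>d. s r = 0) \<longrightarrow> pure_run p s
      (s(d := rec_nat (a (\<lambda>i. s (\<rho> i))) (\<lambda>i acc. B i acc (\<lambda>i. s (\<rho> i))) (n (\<lambda>i. s (\<rho> i)))))"
    by blast
qed

section \<open>Embedding a given program at a register offset\<close>

fun shift_instr :: "nat \<Rightarrow> instr \<Rightarrow> instr" where
  "shift_instr d (Inc r) = Inc (d + r)"
| "shift_instr d (Dec r) = Dec (d + r)"
| "shift_instr d (While r p) = While (d + r) (map (shift_instr d) p)"
| "shift_instr d (Read r) = Read (d + r)"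
| "shift_instr d (Write r) = Write (d + r)"

text \<open>A program mentions finitely many registers, and only these can be left nonzero and need
  clearing after it halts.\<close>

fun regs_below :: "nat \<Rightarrow> instr \<Rightarrow> bool" where
  "regs_below N (Inc r) = (r < N)"
| "regs_below N (Dec r) = (r < N)"
| "regs_below N (While r p) = (r < N \<and> (\<forall>i\<in>set p. regs_below N i))"
| "regs_below N (Read r) = (r < N)"
| "regs_below N (Write r) = (r < N)"

lemma regs_below_mono: "regs_below M i \<Longrightarrow> M \<le> N \<Longrightarrow> regs_below N i"
  by (induction i) auto

lemma regs_below_list:
  assumes "\<And>i. i \<in> set p \<Longrightarrow> \<exists>N. regs_below N i"
  shows "\<exists>N. \<forall>i\<in>set p. regs_below N i"
  using assms
proof (induction p)
  case (Cons i p)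
  obtain M N where "\<forall>j\<in>set p. regs_below M j" "regs_below N i"
    using Cons by (metis list.set_intros)
  then show ?case
    by (intro exI[of _ "max M N"]) (auto intro: regs_below_mono)
qed simp

lemma regs_below_ex: "\<exists>N. regs_below N i"
proof (induction i)
  case (While r p)
  obtain N where "\<forall>i\<in>set p. regs_below N i"
    using regs_below_list[of p] While by blast
  then show ?case
    by (intro exI[of _ "max (Suc r) N"]) (auto intro: regs_below_mono)
qed auto

lemma step_regs_below:
  assumes "\<forall>i\<in>set (control c). regs_below N i" "r \<ge> N"
  shows "(\<forall>i\<in>set (control (step \<beta> c)). regs_below N i) \<and> regs (step \<beta> c) r = regs c r"
proof (cases "control c")
  case (Cons i p)
  then show ?thesis using assms by (cases i) (auto simp: step_def)
qed (use assms in \<open>simp add: step_def\<close>)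

lemma steps_regs_below:
  assumes "\<forall>i\<in>set (control c). regs_below N i" "r \<ge> N"
  shows "(\<forall>i\<in>set (control ((step \<beta> ^^ t) c)). regs_below N i) \<and>
    regs ((step \<beta> ^^ t) c) r = regs c r"
proof (induction t)
  case (Suc t)
  then show ?case using step_regs_below[of "(step \<beta> ^^ t) c" N r \<beta>] assms(2) by simp
qed (use assms in simp)

definition relocate :: "nat \<Rightarrow> (nat \<Rightarrow> nat) \<Rightarrow> machine \<Rightarrow> nat \<Rightarrow> bool list \<Rightarrow> config \<Rightarrow> config" where
  "relocate d s q b w c = conf (map (shift_instr d) (control c) @ q)
    (\<lambda>r. if r < d then s r else regs c (r - d)) b w"

text \<open>The two oracles may differ because no bit is read. A halted \<open>c\<close> is
  excluded: it stays put, while its relocation would go on with \<open>q\<close>.\<close>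

lemma step_relocate:
  assumes "\<forall>i\<in>set (control c). io_free i" "control c \<noteq> []"
  shows "(\<forall>i\<in>set (control (step \<gamma> c)). io_free i) \<and>
    step \<beta> (relocate d s q b w c) = relocate d s q b w (step \<gamma> c)"
proof -
  obtain i p where ip: "control c = i # p" using assms(2) by (cases "control c") auto
  show ?thesis
    by (cases i) (use assms(1) ip in \<open>auto simp: step_def relocate_def fun_eq_iff\<close>)
qed

lemma leads_relocate:
  assumes "\<forall>i\<in>set (control c). io_free i"
  shows "leads \<beta> {(b, w)} (relocate d s q b w c) (relocate d s q b w ((step \<gamma> ^^ t) c))"
  using assms
proof (induction t arbitrary: c)
  case 0
  show ?case by (simp add: leads_refl relocate_def io_def)
next
  case (Suc t)
  have *: "(step \<gamma> ^^ Suc t) c = (step \<gamma> ^^ t) (step \<gamma> c)"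
    by (simp add: funpow_Suc_right del: funpow.simps)
  show ?case
  proof (cases "control c = []")
    case True
    then have "step \<gamma> c = c" by (simp add: step_def)
    then show ?thesis using Suc * by simp
  next
    case False
    note st = step_relocate[OF Suc.prems False, of \<gamma> \<beta> d s q b w]
    have "io (relocate d s q b w c') \<in> {(b, w)}" for c' by (simp add: io_def relocate_def)
    with leads_step[of "relocate d s q b w c" "{(b, w)}" \<beta>] st
    have "leads \<beta> {(b, w)} (relocate d s q b w c) (relocate d s q b w (step \<gamma> c))"
      by metis
    with Suc.IH[of "step \<gamma> c"] st show ?thesis unfolding * by (metis leads_trans)
  qed
qed

lemma pure_run_clear_list: "pure_run (map clear rs) s (\<lambda>r. if r \<in> set rs then 0 else s r)"
proof (induction rs arbitrary: s)
  case Nil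
  then show ?case by (simp add: pure_run_Nil)
next
  case (Cons a rs)
  have "(\<lambda>r. if r \<in> set rs then 0 else (s(a := 0)) r) = (\<lambda>r. if r \<in> set (a # rs) then 0 else s r)"
    by auto
  then show ?case
    using pure_run_Cons[OF pure_run_clear Cons[of "s(a := 0)"]] by (simp del: fun_upd_apply)
qed

text \<open>The notation \<open>1x\<close> never yields zero; subtracting one gives a bijection with
  the natural numbers, with inverse \<open>dec\<close>, so that each round has its string.\<close>

definition enc :: "bool list \<Rightarrow> nat" where
  "enc x = str_code x - 1"

fun dec :: "nat \<Rightarrow> bool list" where
  "dec 0 = []"
| "dec (Suc n) = dec (n div 2) @ [odd n]"

lemma str_code_pos: "0 < str_code x"
  by (induction x rule: rev_induct) (auto simp: str_code_def)

lemma str_code_snoc: "str_code (x @ [b]) = 2 * str_code x + of_bool b"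
  by (simp add: str_code_def)

lemma enc_Nil [simp]: "enc [] = 0"
  by (simp add: enc_def str_code_def)

lemma enc_snoc: "enc (x @ [b]) = 2 * enc x + 1 + of_bool b"
  using str_code_pos[of x] by (simp add: enc_def str_code_snoc diff_mult_distrib2)

lemma enc_dec [simp]: "enc (dec n) = n"
  by (induction n rule: dec.induct) (auto simp: enc_snoc)

lemma dec_enc [simp]: "dec (enc x) = x"
  by (induction x rule: rev_induct) (auto simp: enc_snoc)

lemma str_code_dec: "str_code (dec n) = Suc n"
  using enc_dec[of n] str_code_pos[of "dec n"] unfolding enc_def by linarith

lemma dec_eq_iff [simp]: "dec m = dec n \<longleftrightarrow> m = n"
  by (metis enc_dec)

lemma enc_eq_iff [simp]: "enc x = enc y \<longleftrightarrow> x = y"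
  by (metis dec_enc)

lemma dec_snoc: "dec (2 * n + 1 + of_bool b) = dec n @ [b]"
  by (metis dec_enc enc_dec enc_snoc)

lemma length_dec_bounds: "2 ^ length (dec n) \<le> Suc n \<and> Suc n < 2 ^ Suc (length (dec n))"
proof (induction n rule: dec.induct)
  case (2 n)
  have "Suc (Suc n) = 2 * Suc (n div 2) + n mod 2" by simp
  moreover have "n mod 2 < 2" by simp
  ultimately show ?case using 2 by (auto simp del: mod_less_divisor)
qed simp

text \<open>\<open>Suc n\<close> has binary notation \<open>1x\<close> for \<open>x = dec n\<close>,
  so division by \<open>2 ^ j\<close> drops the last \<open>j\<close> bits of
  \<open>x\<close>.\<close>

lemma dec_div_power: "j \<le> length (dec n) \<Longrightarrow> Suc n div 2 ^ j = Suc (enc (take (length (dec n) - j) (dec n)))"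
proof (induction j)
  case 0
  then show ?case by simp
next
  case (Suc j)
  define y where "y = take (length (dec n) - Suc j) (dec n)"
  define b where "b = dec n ! (length (dec n) - Suc j)"
  have "length (dec n) - j = Suc (length (dec n) - Suc j)" using Suc.prems by simp
  then have t: "take (length (dec n) - j) (dec n) = y @ [b]"
    using Suc.prems by (simp add: y_def b_def take_Suc_conv_app_nth)
  have "Suc n div 2 ^ Suc j = (Suc n div 2 ^ j) div 2"
    by (metis div_mult2_eq mult.commute power_Suc)
  also have "\<dots> = Suc (enc (y @ [b])) div 2" using Suc t by simp
  also have "\<dots> = Suc (enc y)" by (cases b) (auto simp: enc_snoc)
  finally show ?case by (simp add: y_def)
qed

text \<open>Puts the prefix relation into bounded arithmetic, to which the closure rules for
  decidable predicates apply.\<close>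

lemma prefix_dec_iff: "prefix (dec m) (dec n) \<longleftrightarrow> (\<exists>j<Suc n. Suc n div 2 ^ j = Suc m)"
proof
  assume p: "prefix (dec m) (dec n)"
  let ?j = "length (dec n) - length (dec m)"
  have l: "length (dec m) \<le> length (dec n)" using p by (rule prefix_length_le)
  have "take (length (dec m)) (dec n) = dec m" using p by (metis append_eq_conv_conj prefix_def)
  then have "Suc n div 2 ^ ?j = Suc m" using dec_div_power[of ?j n] l by simp
  moreover have "?j < Suc n"
  proof -
    have "?j < 2 ^ length (dec n)"
      by (metis diff_le_self le_less_trans less_exp)
    then show ?thesis using length_dec_bounds[of n] by linarith
  qed
  ultimately show "\<exists>j<Suc n. Suc n div 2 ^ j = Suc m" by blast
next
  assume "\<exists>j<Suc n. Suc n div 2 ^ j = Suc m"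
  then obtain j where j: "Suc n div 2 ^ j = Suc m" by blast
  have "j \<le> length (dec n)"
  proof (rule ccontr)
    assume "\<not> ?thesis"
    then have "(2::nat) ^ Suc (length (dec n)) \<le> 2 ^ j" by (intro power_increasing) auto
    then have "Suc n < 2 ^ j" using length_dec_bounds[of n] by linarith
    then show False using j by simp
  qed
  then have "m = enc (take (length (dec n) - j) (dec n))" using dec_div_power j by force
  then show "prefix (dec m) (dec n)" by (metis dec_enc take_is_prefix)
qed

lemma length_dec_sum: "length (dec n) = (\<Sum>j<n. of_bool (2 ^ Suc j \<le> Suc n))"
proof -
  have "j < length (dec n) \<longleftrightarrow> j < n \<and> 2 ^ Suc j \<le> Suc n" for j
  proof
    assume "j < length (dec n)"
    then have "(2::nat) ^ Suc j \<le> 2 ^ length (dec n)" by (intro power_increasing) auto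
    then have "2 ^ Suc j \<le> Suc n" using length_dec_bounds[of n] by linarith
    moreover have "Suc j < 2 ^ Suc j" by (rule less_exp)
    ultimately show "j < n \<and> 2 ^ Suc j \<le> Suc n" by linarith
  next
    assume "j < n \<and> 2 ^ Suc j \<le> Suc n"
    then have "(2::nat) ^ Suc j < 2 ^ Suc (length (dec n))"
      using length_dec_bounds[of n] by linarith
    then show "j < length (dec n)" using power_less_imp_less_exp[of "2::nat" "Suc j"] by simp
  qed
  then have "{..<length (dec n)} = {j. j < n \<and> 2 ^ Suc j \<le> Suc n}" by auto
  moreover have "(\<Sum>j<n. of_bool (2 ^ Suc j \<le> Suc n)) = card {j. j < n \<and> 2 ^ Suc j \<le> Suc n}"
    using sum_of_bool_eq[of "{..<n}" "\<lambda>j. 2 ^ Suc j \<le> Suc n", where ?'a = nat] by (simp add: Collect_conj_eq lessThan_def)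
  ultimately show ?thesis by (metis card_lessThan)
qed

lemma computable_fun_dec:
  assumes "total_computable f" "computable e"
  shows "computable (\<lambda>s. f (dec (e s)))"
  unfolding computable_def
proof (intro allI)
  fix \<rho> d
  obtain p where iofree: "\<forall>i\<in>set p. io_free i"
    and halts: "\<And>x. \<exists>t. let c = (step (\<lambda>_. False) ^^ t) (start p ((\<lambda>_. 0)(0 := str_code x)))
      in control c = [] \<and> regs c 0 = f x"
    using assms(1) unfolding total_computable_def by blast
  obtain N where N: "\<forall>i\<in>set p. regs_below N i"
    using regs_below_list regs_below_ex by blast
  obtain pe where pe: "\<And>s. (\<And>r. r \<ge> d \<Longrightarrow> s r = 0) \<Longrightarrow> pure_run pe s (s(d := e (\<lambda>i. s (\<rho> i))))"
    using computableE[OF assms(2)] by blast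
  \<comment> \<open>\<open>Inc d\<close> turns the code \<open>n\<close> into
    \<open>str_code (dec n)\<close>, the input format of \<open>total_computable\<close>. The final
    clearing restores the zeroed stack above the result.\<close>
  have "pure_run (pe @ [Inc d] @ map (shift_instr d) p @ map clear [Suc d..<d + N]) s
      (s(d := f (dec (e (\<lambda>i. s (\<rho> i))))))"
    if z: "\<forall>r\<ge>d. s r = 0" for s
  proof -
    define n where "n = e (\<lambda>i. s (\<rho> i))"
    have 1: "pure_run pe s (s(d := n))" unfolding n_def using z by (intro pe) auto
    have 2: "pure_run [Inc d] (s(d := n)) (s(d := Suc n))"
      using pure_run_Inc[of d "s(d := n)"] by simp
    define c0 where "c0 = start p ((\<lambda>_. 0)(0 := str_code (dec n)))"
    obtain t where t: "control ((step (\<lambda>_. False) ^^ t) c0) = []"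
      "regs ((step (\<lambda>_. False) ^^ t) c0) 0 = f (dec n)"
      using halts[of "dec n"] by (auto simp: Let_def c0_def)
    define s' where "s' = (\<lambda>r. if r < d then s r else regs ((step (\<lambda>_. False) ^^ t) c0) (r - d))"
    have init: "relocate d s q b w c0 = conf (map (shift_instr d) p @ q) (s(d := Suc n)) b w" for q b w
      using z by (auto simp: relocate_def c0_def start_def str_code_dec)
    have final: "relocate d s q b w ((step (\<lambda>_. False) ^^ t) c0) = conf q s' b w" for q b w
      using t by (simp add: relocate_def s'_def)
    have 3: "pure_run (map (shift_instr d) p) (s(d := Suc n)) s'"
      unfolding pure_run_def
      using leads_relocate[where c = c0 and d = d and s = s and t = t and \<gamma> = "\<lambda>_. False"] iofree
      by (simp add: init final) (simp add: c0_def start_def)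
    have "s' r = 0" if "r \<ge> d + N" "r > d" for r
      using steps_regs_below[of c0 N "r - d" t "\<lambda>_. False"] N that by (auto simp: s'_def c0_def start_def)
    then have "(\<lambda>r. if r \<in> set [Suc d..<d + N] then 0 else s' r) = s(d := f (dec n))"
      using z t(2) by (auto simp: s'_def fun_eq_iff)
    then have 4: "pure_run (map clear [Suc d..<d + N]) s' (s(d := f (dec n)))"
      using pure_run_clear_list[of "[Suc d..<d + N]" s'] by (simp only:)
    show ?thesis
      using pure_run_append[OF 1 pure_run_append[OF 2 pure_run_append[OF 3 4]]] by (simp add: n_def)
  qed
  then show "\<exists>p. \<forall>s. (\<forall>r\<ge>d. s r = 0) \<longrightarrow> pure_run p s (s(d := f (dec (e (\<lambda>i. s (\<rho> i))))))" by blast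
qed

section \<open>Closure properties of computable functions and decidable predicates\<close>

named_theorems computable_intros

lemma computable_const [computable_intros]: "computable (\<lambda>s. k)"
  by (induction k) (rule computable_0, rule computable_Suc)

declare computable_var [computable_intros] computable_Suc [computable_intros]

lemma computable_add [computable_intros]:
  assumes "computable a" "computable b"
  shows "computable (\<lambda>s. a s + b s)"
proof -
  have "rec_nat m (\<lambda>i. Suc) n = m + n" for m n :: nat by (induction n) auto
  moreover have "computable (\<lambda>s. rec_nat (a s) (\<lambda>i acc. Suc acc) (b s))"
    by (intro computable_rec[of "\<lambda>i acc s. Suc acc"] assms computable_intros)
  ultimately show ?thesis by simp
qed

lemma computable_diff [computable_intros]:
  assumes "computable a" "computable b"
  shows "computable (\<lambda>s. a s - b s)"
proof -
  have "rec_nat m (\<lambda>i acc. acc - 1) n = m - n" for m n :: nat by (induction n) auto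
  moreover have "computable (\<lambda>s. rec_nat (a s) (\<lambda>i acc. acc - 1) (b s))"
    by (intro computable_rec[of "\<lambda>i acc s. acc - 1"] assms computable_intros computable_pred)
  ultimately show ?thesis by simp
qed

lemma computable_mult [computable_intros]:
  assumes "computable a" "computable b"
  shows "computable (\<lambda>s. a s * b s)"
proof -
  have "rec_nat 0 (\<lambda>i acc. acc + m) n = m * n" for m n :: nat by (induction n) auto
  moreover have "computable (\<lambda>s. rec_nat 0 (\<lambda>i acc. acc + a s) (b s))"
    by (intro computable_rec[of "\<lambda>i acc s. acc + a s"] assms computable_intros
        computable_rename[OF assms(1), of "\<lambda>i. Suc (Suc i)"])
  ultimately show ?thesis by simp
qed

lemma computable_power [computable_intros]:
  assumes "computable a" "computable b"
  shows "computable (\<lambda>s. a s ^ b s)"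
proof -
  have "rec_nat 1 (\<lambda>i acc. acc * m) n = m ^ n" for m n :: nat by (induction n) auto
  moreover have "computable (\<lambda>s. rec_nat 1 (\<lambda>i acc. acc * a s) (b s))"
    by (intro computable_rec[of "\<lambda>i acc s. acc * a s"] assms computable_intros
        computable_rename[OF assms(1), of "\<lambda>i. Suc (Suc i)"])
  ultimately show ?thesis by simp
qed

lemma computable_sum [computable_intros]:
  assumes "computable n" "computable (\<lambda>s. f (s 0) (\<lambda>i. s (Suc i)))"
  shows "computable (\<lambda>s. \<Sum>i<n s. f i s)"
proof -
  have "rec_nat 0 (\<lambda>i acc. acc + g i) n = (\<Sum>i<n. g i)" for g :: "nat \<Rightarrow> nat" and n
    by (induction n) auto
  moreover have "computable (\<lambda>s. rec_nat 0 (\<lambda>i acc. acc + f i s) (n s))"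
    \<comment> \<open>The summand binds only the index; the renaming skips the accumulator of the
      recursion.\<close>
    using computable_rename[OF assms(2), of "case_nat 0 (\<lambda>i. Suc (Suc i))"]
    by (intro computable_rec[of "\<lambda>i acc s. acc + f i s"] assms(1) computable_intros) simp
  ultimately show ?thesis by simp
qed

abbreviation decidable :: "((nat \<Rightarrow> nat) \<Rightarrow> bool) \<Rightarrow> bool" where
  "decidable P \<equiv> computable (\<lambda>s. of_bool (P s))"

lemma decidable_le [computable_intros]:
  "computable a \<Longrightarrow> computable b \<Longrightarrow> decidable (\<lambda>s. a s \<le> b s)"
proof -
  assume "computable a" "computable b"
  then have "computable (\<lambda>s. 1 - (a s - b s))" by (intro computable_intros)
  moreover have "of_bool (a s \<le> b s) = (1 - (a s - b s) :: nat)" for s by auto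
  ultimately show ?thesis by simp
qed

lemma decidable_not [computable_intros]: "decidable P \<Longrightarrow> decidable (\<lambda>s. \<not> P s)"
proof -
  assume "decidable P"
  then have "computable (\<lambda>s. 1 - of_bool (P s))" by (intro computable_intros)
  moreover have "of_bool (\<not> P s) = (1 - of_bool (P s) :: nat)" for s by auto
  ultimately show ?thesis by simp
qed

lemma decidable_conj [computable_intros]:
  "decidable P \<Longrightarrow> decidable Q \<Longrightarrow> decidable (\<lambda>s. P s \<and> Q s)"
proof -
  assume "decidable P" "decidable Q"
  then have "computable (\<lambda>s. of_bool (P s) * of_bool (Q s))" by (intro computable_intros)
  then show ?thesis by (simp only: of_bool_conj)
qed

lemma decidable_disj [computable_intros]:
  assumes "decidable P" "decidable Q"
  shows "decidable (\<lambda>s. P s \<or> Q s)"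
proof -
  have "decidable (\<lambda>s. \<not> (\<not> P s \<and> \<not> Q s))" by (intro computable_intros assms)
  then show ?thesis by simp
qed

lemma decidable_imp [computable_intros]:
  assumes "decidable P" "decidable Q"
  shows "decidable (\<lambda>s. P s \<longrightarrow> Q s)"
proof -
  have "decidable (\<lambda>s. \<not> P s \<or> Q s)" by (intro computable_intros assms)
  then show ?thesis by (simp only: imp_conv_disj)
qed

lemma decidable_less [computable_intros]:
  "computable a \<Longrightarrow> computable b \<Longrightarrow> decidable (\<lambda>s. a s < b s)"
  using decidable_not[OF decidable_le[of b a]] by (simp only: not_le)

lemma decidable_eq [computable_intros]:
  "computable a \<Longrightarrow> computable b \<Longrightarrow> decidable (\<lambda>s. a s = b s)"
  unfolding eq_iff[of "a _"] by (intro decidable_conj decidable_le)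

lemma decidable_ex [computable_intros]:
  assumes "computable n" "decidable (\<lambda>s. P (s 0) (\<lambda>i. s (Suc i)))"
  shows "decidable (\<lambda>s. \<exists>i<n s. P i s)"
proof -
  have "decidable (\<lambda>s. 0 < (\<Sum>i<n s. of_bool (P i s) :: nat))"
    by (intro computable_intros assms)
  moreover have "0 < (\<Sum>i<n s. of_bool (P i s) :: nat) \<longleftrightarrow> (\<exists>i<n s. P i s)" for s
    by (auto simp: zero_less_iff_neq_zero)
  ultimately show ?thesis by simp
qed

lemma decidable_all [computable_intros]:
  assumes "computable n" "decidable (\<lambda>s. P (s 0) (\<lambda>i. s (Suc i)))"
  shows "decidable (\<lambda>s. \<forall>i<n s. P i s)"
proof -
  have "decidable (\<lambda>s. \<not> (\<exists>i<n s. \<not> P i s))" by (intro computable_intros assms)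
  then show ?thesis by simp
qed

lemma computable_div [computable_intros]:
  assumes "computable a" "computable b"
  shows "computable (\<lambda>s. a s div b s)"
proof -
  \<comment> \<open>For positive \<open>n\<close> the quotient counts the \<open>q\<close> with
    \<open>Suc q * n \<le> m\<close>. The factor enforces that division by zero gives zero.\<close>
  have "m div n = of_bool (0 < n) * (\<Sum>q<m. of_bool (Suc q * n \<le> m))" for m n :: nat
  proof (cases "n = 0")
    case False
    have "q < m div n \<longleftrightarrow> q < m \<and> Suc q * n \<le> m" for q
      using False less_eq_div_iff_mult_less_eq[of n "Suc q" m] div_le_dividend[of m n]
      by (metis Suc_le_eq less_le_trans neq0_conv)
    then have "{..<m div n} = {q. q < m \<and> Suc q * n \<le> m}" by auto
    moreover have "(\<Sum>q<m. of_bool (Suc q * n \<le> m)) = card {q. q < m \<and> Suc q * n \<le> m}"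
      using sum_of_bool_eq[of "{..<m}" "\<lambda>q. Suc q * n \<le> m", where ?'a = nat]
      by (simp add: Collect_conj_eq lessThan_def)
    ultimately have "m div n = (\<Sum>q<m. of_bool (Suc q * n \<le> m))"
      by (metis card_lessThan)
    then show ?thesis using False by simp
  qed simp
  moreover have "computable (\<lambda>s. of_bool (0 < b s) * (\<Sum>q<a s. of_bool (Suc q * b s \<le> a s)))"
    by (intro computable_intros assms computable_rename[OF assms(1)] computable_rename[OF assms(2)])
  ultimately show ?thesis by (simp only:)
qed

lemma decidable_odd [computable_intros]: "computable a \<Longrightarrow> decidable (\<lambda>s. odd (a s))"
proof -
  assume a: "computable a"
  have "odd m \<longleftrightarrow> m \<noteq> 2 * (m div 2)" for m :: nat by presburger
  moreover have "decidable (\<lambda>s. a s \<noteq> 2 * (a s div 2))" by (intro computable_intros a)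
  ultimately show ?thesis by (simp only:)
qed

lemma computable_prod_encode [computable_intros]:
  assumes "computable a" "computable b"
  shows "computable (\<lambda>s. prod_encode (a s, b s))"
proof -
  have "prod_encode (m, n) = ((m + n) * Suc (m + n)) div 2 + m" for m n
    by (simp add: prod_encode_def triangle_def)
  moreover have "computable (\<lambda>s. ((a s + b s) * Suc (a s + b s)) div 2 + a s)"
    by (intro computable_intros assms)
  ultimately show ?thesis by (simp only:)
qed

lemma decidable_prefix [computable_intros]:
  assumes "computable a" "computable b"
  shows "decidable (\<lambda>s. prefix (dec (a s)) (dec (b s)))"
  unfolding prefix_dec_iff
  by (intro computable_intros assms computable_rename[OF assms(1)] computable_rename[OF assms(2)])

lemma computable_length [computable_intros]:
  assumes "computable a"
  shows "computable (\<lambda>s. length (dec (a s)))"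
  unfolding length_dec_sum by (intro computable_intros assms computable_rename[OF assms])

section \<open>Allocation of cylinders\<close>

definition begins :: "bitseq \<Rightarrow> bool list \<Rightarrow> bool" where
  "begins \<beta> c \<longleftrightarrow> \<beta> \<restriction> length c = c"

lemma length_restr [simp]: "length (\<beta> \<restriction> n) = n"
  by (simp add: restr_def)

lemma take_restr: "take m (\<beta> \<restriction> n) = \<beta> \<restriction> min m n"
  by (rule nth_equalityI) (auto simp: restr_def)

lemma begins_iff_nth: "begins \<beta> c \<longleftrightarrow> (\<forall>i<length c. \<beta> i = c ! i)"
  unfolding begins_def restr_def list_eq_iff_nth_eq[of "map \<beta> _"] by simp

lemma begins_append:
  "begins \<beta> (c @ d) \<longleftrightarrow> begins \<beta> c \<and> (\<forall>i<length d. \<beta> (length c + i) = d ! i)"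
proof -
  have "(\<forall>i<length c + length d. P i) \<longleftrightarrow>
      (\<forall>i<length c. P i) \<and> (\<forall>i<length d. P (length c + i))" for P
  proof safe
    fix i assume "\<forall>i<length c. P i" "\<forall>i<length d. P (length c + i)" "i < length c + length d"
    then show "P i" by (cases "i < length c") (auto dest: spec[of _ "i - length c"])
  qed auto
  then show ?thesis by (auto simp: begins_iff_nth nth_append)
qed

lemma begins_Nil [simp]: "begins \<beta> []"
  by (simp add: begins_iff_nth)

lemma begins_restr [simp]: "begins \<beta> (\<beta> \<restriction> n)"
  by (simp add: begins_def)

lemma begins_prefix: "prefix c d \<Longrightarrow> begins \<beta> d \<Longrightarrow> begins \<beta> c"
  by (auto simp: prefix_def begins_append)

lemma begins_comparable: "begins \<beta> c \<Longrightarrow> begins \<beta> d \<Longrightarrow> length c \<le> length d \<Longrightarrow> prefix c d"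
  using take_restr[of "length c" \<beta> "length d"] take_is_prefix[of "length c" d]
  by (simp add: begins_def min_absorb1)

lemma begins_ex: "\<exists>\<beta>. begins \<beta> c"
  by (intro exI[of _ "\<lambda>i. c ! i"]) (simp add: begins_iff_nth)

text \<open>A piece \<open>(c, w)\<close> is a cylinder \<open>c\<close> of oracles on which the output known so far
  is \<open>w\<close>.\<close>

type_synonym piece = "bool list \<times> bool list"

text \<open>Giving part of \<open>c\<close> to \<open>x\<close> lets the output there pass through
  every string between \<open>w\<close> and \<open>x\<close>, so each of these must be able to gain
  a whole cylinder inside \<open>c\<close> within its own bound.\<close>

definition usable :: "(bool list \<Rightarrow> nat) \<Rightarrow> bool list \<Rightarrow> piece \<Rightarrow> bool" where
  "usable K x = (\<lambda>(c, w). strict_prefix w x \<and>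
    (\<forall>u. strict_prefix w u \<longrightarrow> prefix u x \<longrightarrow> length c \<le> K u))"

definition selected :: "(bool list \<Rightarrow> nat) \<Rightarrow> bool list \<Rightarrow> piece set \<Rightarrow> piece \<Rightarrow> bool" where
  "selected K x S p \<longleftrightarrow> p \<in> S \<and> usable K x p \<and>
    (\<forall>q\<in>S. usable K x q \<longrightarrow> length (snd q) < length (snd p) \<or>
      snd q = snd p \<and> length (fst q) \<le> length (fst p))"

text \<open>The cylinder \<open>c\<close>, labelled \<open>w\<close>, is cut down to a subcylinder of length \<open>K x\<close> for \<open>x\<close>;
  the offcut of length \<open>l + 1\<close> belongs to the longest \<open>v\<close> on the path from \<open>w\<close> to \<open>x\<close> that
  needed a cylinder of length at most \<open>l\<close>.\<close>

definition offcut_label :: "(bool list \<Rightarrow> nat) \<Rightarrow> bool list \<Rightarrow> bool list \<Rightarrow> nat \<Rightarrow> bool list \<Rightarrow> bool" where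
  "offcut_label K x w l v \<longleftrightarrow> prefix w v \<and> prefix v x \<and> (v = w \<or> K v \<le> l) \<and>
    (\<forall>u. strict_prefix v u \<longrightarrow> prefix u x \<longrightarrow> l < K u)"

definition trim :: "(bool list \<Rightarrow> nat) \<Rightarrow> bool list \<Rightarrow> piece \<Rightarrow> piece set" where
  "trim K x = (\<lambda>(c, w). {(c @ replicate j False @ [True], v) | j v.
      j < K x - length c \<and> offcut_label K x w (length c + j) v} \<union>
    {(c @ replicate (K x - length c) False, x)})"

text \<open>A predicate takes the place of a chosen piece, so that membership can be decided by
  bounded search; in an allocation at most one piece is selected.\<close>

definition refine :: "(bool list \<Rightarrow> nat) \<Rightarrow> bool list \<Rightarrow> piece set \<Rightarrow> piece set" where
  "refine K x S = {p \<in> S. \<not> selected K x S p} \<union> (\<Union>p\<in>{p \<in> S. selected K x S p}. trim K x p)"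

text \<open>The sum clause stands for the measure of Cantor space. The last three clauses keep the
  measure at a nonempty label \<open>w\<close> within \<open>(1/2) ^ K w\<close>: there is either a
  single cylinder of length \<open>K w\<close>, or only different lengths above \<open>K w\<close>.
  The empty label is exempt because it starts with the whole space.\<close>

definition allocation :: "(bool list \<Rightarrow> nat) \<Rightarrow> bool list set \<Rightarrow> piece set \<Rightarrow> bool" where
  "allocation K W S \<longleftrightarrow> finite S \<and> snd ` S \<subseteq> W \<and>
    (\<forall>\<beta>. \<exists>!p. p \<in> S \<and> begins \<beta> (fst p)) \<and>
    (\<Sum>p\<in>S. (1/2 :: real) ^ length (fst p)) = 1 \<and>
    (\<forall>c d w. (c, w) \<in> S \<longrightarrow> (d, w) \<in> S \<longrightarrow> length c = length d \<longrightarrow> c = d) \<and>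
    (\<forall>c w. (c, w) \<in> S \<longrightarrow> w \<noteq> [] \<longrightarrow> K w \<le> length c) \<and>
    (\<forall>c d w. (c, w) \<in> S \<longrightarrow> (d, w) \<in> S \<longrightarrow> w \<noteq> [] \<longrightarrow> length c = K w \<longrightarrow> c = d)"

lemma allocationD:
  assumes "allocation K W S"
  shows allocation_finite: "finite S"
    and allocation_labels: "(c, w) \<in> S \<Longrightarrow> w \<in> W"
    and allocation_ex: "\<exists>c w. (c, w) \<in> S \<and> begins \<beta> c"
    and allocation_unique: "(c, w) \<in> S \<Longrightarrow> (d, v) \<in> S \<Longrightarrow> begins \<beta> c \<Longrightarrow> begins \<beta> d \<Longrightarrow> c = d \<and> w = v"
    and allocation_sum: "(\<Sum>p\<in>S. (1/2 :: real) ^ length (fst p)) = 1"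
    and allocation_length: "(c, w) \<in> S \<Longrightarrow> (d, w) \<in> S \<Longrightarrow> length c = length d \<Longrightarrow> c = d"
    and allocation_ge: "(c, w) \<in> S \<Longrightarrow> w \<noteq> [] \<Longrightarrow> K w \<le> length c"
    and allocation_eq: "(c, w) \<in> S \<Longrightarrow> (d, w) \<in> S \<Longrightarrow> w \<noteq> [] \<Longrightarrow> length c = K w \<Longrightarrow> c = d"
proof -
  have 1: "finite S" "snd ` S \<subseteq> W" "(\<Sum>p\<in>S. (1/2 :: real) ^ length (fst p)) = 1"
    and 2: "\<forall>\<beta>. \<exists>!p. p \<in> S \<and> begins \<beta> (fst p)"
    and 3: "\<forall>c d w. (c, w) \<in> S \<longrightarrow> (d, w) \<in> S \<longrightarrow> length c = length d \<longrightarrow> c = d"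
    and 4: "\<forall>c w. (c, w) \<in> S \<longrightarrow> w \<noteq> [] \<longrightarrow> K w \<le> length c"
    and 5: "\<forall>c d w. (c, w) \<in> S \<longrightarrow> (d, w) \<in> S \<longrightarrow> w \<noteq> [] \<longrightarrow> length c = K w \<longrightarrow> c = d"
    using assms unfolding allocation_def by - (elim conjE, assumption)+
  show "finite S" "(\<Sum>p\<in>S. (1/2 :: real) ^ length (fst p)) = 1" by (rule 1)+
  show "w \<in> W" if "(c, w) \<in> S"
    using subsetD[OF 1(2) imageI[OF that, of snd]] by simp
  have ex1: "\<exists>!p. p \<in> S \<and> begins \<beta> (fst p)" using 2 by (rule spec)
  then obtain p where "p \<in> S" "begins \<beta> (fst p)" by (elim ex1E conjE)
  then show "\<exists>c w. (c, w) \<in> S \<and> begins \<beta> c" by (cases p) auto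
  show "c = d \<and> w = v" if "(c, w) \<in> S" "(d, v) \<in> S" "begins \<beta> c" "begins \<beta> d"
    using ex1 that by (metis fst_conv snd_conv)
  show "c = d" if "(c, w) \<in> S" "(d, w) \<in> S" "length c = length d" using 3 that by blast
  show "K w \<le> length c" if "(c, w) \<in> S" "w \<noteq> []" using 4 that by blast
  show "c = d" if "(c, w) \<in> S" "(d, w) \<in> S" "w \<noteq> []" "length c = K w" using 5 that by blast
qed

text \<open>Distinct lengths above \<open>l\<close> pick terms of the geometric series with sum
  \<open>(1/2) ^ l\<close>; a finite set misses a positive remainder, hence strictness.\<close>

lemma sum_half_powers_less:
  assumes "finite C" "inj_on length C" "\<And>c. c \<in> C \<Longrightarrow> l < length c"
  shows "(\<Sum>c\<in>C. (1/2 :: real) ^ length c) < (1/2) ^ l"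
proof -
  \<comment> \<open>Inserting \<open>l\<close> keeps the maximum meaningful, and at least
    \<open>l\<close>, for empty \<open>C\<close>.\<close>
  define M where "M = Max (insert l (length ` C))"
  have M: "length ` C \<subseteq> {l<..M}" "l \<le> M"
    using assms by (auto simp: M_def)
  have "(\<Sum>c\<in>C. (1/2 :: real) ^ length c) = (\<Sum>n\<in>length ` C. (1/2) ^ n)"
    by (simp add: sum.reindex[OF assms(2)])
  also have "\<dots> \<le> (\<Sum>n\<in>{l<..M}. (1/2) ^ n)"
    using M by (intro sum_mono2) auto
  also have "\<dots> = (1/2) ^ l - (1/2) ^ M"
    using \<open>l \<le> M\<close>
  proof (induction M rule: dec_induct)
    case (step n)
    then have "{l<..Suc n} = insert (Suc n) {l<..n}" by auto
    then show ?case using step by simp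
  qed simp
  also have "\<dots> < (1/2) ^ l" by simp
  finally show ?thesis .
qed

text \<open>A load is carried along the path: \<open>f 0\<close> travels to an index
  \<open>j\<close> with \<open>f 0 < a j\<close>, is paid for there, and \<open>f j\<close> becomes
  the next load. In between, \<open>f i \<le> a i\<close> applies. The last load is paid at
  \<open>n\<close>.\<close>

lemma path_sum_less:
  fixes f a :: "nat \<Rightarrow> real"
  assumes strict: "\<And>i. i < n \<Longrightarrow> \<exists>j. i < j \<and> j \<le> n \<and> f i < a j"
    and le: "\<And>i. 0 < i \<Longrightarrow> f i \<le> a i" and "0 < n"
  shows "(\<Sum>i<n. f i) < (\<Sum>i\<in>{0<..n}. a i)"
proof -
  \<comment> \<open>\<open>g\<close> is the load carried past \<open>k\<close>, and \<open>j\<close>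
    a place ahead where it can be paid.\<close>
  have *: "g + (\<Sum>i\<in>{k<..<n}. f i) < (\<Sum>i\<in>{k<..n}. a i)"
    if "k < j" "j \<le> n" "g < a j" for g k j
    using that
  proof (induction "n - k" arbitrary: k g j)
    case 0
    then show ?case by simp
  next
    case (Suc m)
    show ?case
    proof (cases "Suc k = n")
      case True
      then have "{k<..<n} = {}" "{k<..n} = {n}" "j = n" using Suc.prems by auto
      then show ?thesis using Suc.prems by simp
    next
      case False
      then have k: "Suc k < n" using Suc.prems by simp
      then have e: "{k<..<n} = insert (Suc k) {Suc k<..<n}" "{k<..n} = insert (Suc k) {Suc k<..n}"
        by auto
      show ?thesis
      proof (cases "j = Suc k")
        case True
        obtain j' where "Suc k < j'" "j' \<le> n" "f (Suc k) < a j'" using strict k by blast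
        then have "f (Suc k) + (\<Sum>i\<in>{Suc k<..<n}. f i) < (\<Sum>i\<in>{Suc k<..n}. a i)"
          using Suc.hyps by (intro Suc.hyps(1)) auto
        then show ?thesis using e True Suc.prems by simp
      next
        case False
        then have "g + (\<Sum>i\<in>{Suc k<..<n}. f i) < (\<Sum>i\<in>{Suc k<..n}. a i)"
          using Suc by (intro Suc.hyps(1)[of _ j]) auto
        then show ?thesis using e le[of "Suc k"] by simp
      qed
    qed
  qed
  obtain j where "0 < j" "j \<le> n" "f 0 < a j" using strict \<open>0 < n\<close> by blast
  from *[OF this] have "f 0 + (\<Sum>i\<in>{0<..<n}. f i) < (\<Sum>i\<in>{0<..n}. a i)" .
  moreover have "{..<n} = insert 0 {0<..<n}" using \<open>0 < n\<close> by auto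
  ultimately show ?thesis by simp
qed

text \<open>If nothing is usable, each proper prefix of \<open>x\<close> owns less than
  \<open>(1/2) ^ K u\<close> for the cheapest \<open>u\<close> beyond it on the path. Shifting these
  charges replaces the proper prefixes of \<open>x\<close> by its nonempty prefixes,
  \<open>x\<close> included. Off the path each label owns at most its own weight, so the total
  measure 1 falls below a finite Kraft sum.\<close>

lemma usable_exists:
  assumes S: "allocation K W S" and x: "x \<notin> W" and W: "finite W" "[] \<in> W"
    and kraft: "\<And>F. finite F \<Longrightarrow> (\<Sum>x\<in>F. (1/2 :: real) ^ K x) \<le> 1"
  shows "\<exists>p\<in>S. usable K x p"
proof (rule ccontr)
  assume none: "\<not> ?thesis"
  define C where "C w = {c. (c, w) \<in> S}" for w
  have fin: "finite (C w)" for w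
    using finite_imageI[OF allocation_finite[OF S], of fst] by (rule finite_subset[rotated]) (force simp: C_def)
  have inj: "inj_on length (C w)" for w
    using allocation_length[OF S] by (auto simp: inj_on_def C_def)
  define f where "f w = (\<Sum>c\<in>C w. (1/2 :: real) ^ length c)" for w
  define a where "a w = (1/2 :: real) ^ K w" for w
  have f_le: "f w \<le> a w" if "w \<noteq> []" for w
  proof (cases "\<exists>c\<in>C w. length c = K w")
    case True
    then obtain c where c: "c \<in> C w" "length c = K w" by blast
    then have "C w = {c}" using allocation_eq[OF S _ _ that] by (auto simp: C_def)
    then show ?thesis using c by (simp add: f_def a_def)
  next
    case False
    then have "\<And>c. c \<in> C w \<Longrightarrow> K w < length c"
      using allocation_ge[OF S _ that] by (force simp: C_def)
    then show ?thesis
      using sum_half_powers_less[OF fin inj] by (force simp: f_def a_def intro: less_imp_le)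
  qed
  have f_less: "\<exists>u. strict_prefix w u \<and> prefix u x \<and> f w < a u" if w: "strict_prefix w x" for w
  proof -
    obtain u where u: "strict_prefix w u" "prefix u x"
      and min: "\<And>v. strict_prefix w v \<Longrightarrow> prefix v x \<Longrightarrow> K u \<le> K v"
      using ex_has_least_nat[of "\<lambda>u. strict_prefix w u \<and> prefix u x" x K] w by blast
    \<comment> \<open>\<open>K u\<close> is minimal on the path beyond \<open>w\<close>, so a
      cylinder of length at most \<open>K u\<close> would be usable.\<close>
    have "K u < length c" if "c \<in> C w" for c
      using none that w min by (force simp: C_def usable_def not_le dest: less_le_trans)
    then show ?thesis
      using u sum_half_powers_less[OF fin inj] by (force simp: f_def a_def)
  qed
  have "x \<noteq> []" using x W by auto
  define n where "n = length x"
  have path: "(\<Sum>i<n. f (take i x)) < (\<Sum>i\<in>{0<..n}. a (take i x))"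
  proof (rule path_sum_less)
    show "0 < n" using \<open>x \<noteq> []\<close> by (simp add: n_def)
    show "f (take i x) \<le> a (take i x)" if "0 < i" for i
      using that \<open>x \<noteq> []\<close> by (intro f_le) auto
    show "\<exists>j>i. j \<le> n \<and> f (take i x) < a (take j x)" if "i < n" for i
    proof -
      have "strict_prefix (take i x) x"
        using that by (auto simp: n_def strict_prefix_def take_is_prefix)
      then obtain u where u: "strict_prefix (take i x) u" "prefix u x" "f (take i x) < a u"
        using f_less by blast
      have "u = take (length u) x" using u(2) by (auto simp: prefix_def)
      moreover have "i < length u"
        using prefix_length_less[OF u(1)] that by (simp add: n_def)
      moreover have "length u \<le> n" using u(2) prefix_length_le n_def by blast
      ultimately show ?thesis using u(3) by metis
    qed
  qed
  have inj1: "inj_on (\<lambda>i. take i x) {..n}"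
    by (auto simp: inj_on_def n_def) (metis length_take min.absorb2)
  define P where "P = (\<lambda>i. take i x) ` {..<n}"
  define Q where "Q = (\<lambda>i. take i x) ` {0<..n}"
  have PQ: "(\<Sum>w\<in>P. f w) < (\<Sum>w\<in>Q. a w)"
  proof -
    have "inj_on (\<lambda>i. take i x) {..<n}" "inj_on (\<lambda>i. take i x) {0<..n}"
      by (rule inj_on_subset[OF inj1]; force)+
    then show ?thesis using path by (simp add: P_def Q_def sum.reindex)
  qed
  define R where "R = W - P"
  have "length w < n" if "w \<in> P" for w using that by (auto simp: P_def n_def)
  then have xP: "x \<notin> P" by (auto simp: n_def)
  have "[] \<in> P" using \<open>x \<noteq> []\<close> by (force simp: P_def n_def)
  then have R: "(\<Sum>w\<in>R. f w) \<le> (\<Sum>w\<in>R. a w)"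
    by (intro sum_mono f_le) (auto simp: R_def)
  \<comment> \<open>No string is charged twice: \<open>x\<close> is new, and the rest of
    \<open>Q\<close> lies in \<open>P\<close>, which \<open>R\<close> avoids.\<close>
  have "Q \<subseteq> insert x P"
    by (auto simp: Q_def P_def n_def image_iff)
  then have "Q \<inter> R = {}" using x by (auto simp: R_def)
  have fins: "finite P" "finite Q" "finite R" using W by (auto simp: P_def Q_def R_def)
  have "(1 :: real) = (\<Sum>p\<in>S. (1/2) ^ length (fst p))"
    using allocation_sum[OF S] by simp
  also have "\<dots> = (\<Sum>w\<in>P \<union> R. \<Sum>p | p \<in> S \<and> snd p = w. (1/2) ^ length (fst p))"
    using allocation_labels[OF S] fins allocation_finite[OF S]
    by (intro sum.group[symmetric]) (auto simp: R_def)
  also have "\<dots> = (\<Sum>w\<in>P \<union> R. f w)"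
  proof (rule sum.cong[OF refl])
    fix w
    have "{p. p \<in> S \<and> snd p = w} = (\<lambda>c. (c, w)) ` C w" by (force simp: C_def)
    then show "(\<Sum>p | p \<in> S \<and> snd p = w. (1/2 :: real) ^ length (fst p)) = f w"
      unfolding f_def by (simp add: sum.reindex inj_on_def)
  qed
  also have "\<dots> = (\<Sum>w\<in>P. f w) + (\<Sum>w\<in>R. f w)"
    using fins by (intro sum.union_disjoint) (auto simp: R_def)
  also have "\<dots> < (\<Sum>w\<in>Q. a w) + (\<Sum>w\<in>R. a w)" using PQ R by simp
  also have "\<dots> = (\<Sum>w\<in>Q \<union> R. a w)"
    using fins \<open>Q \<inter> R = {}\<close> by (intro sum.union_disjoint[symmetric]) auto
  also have "\<dots> \<le> 1" unfolding a_def using fins by (intro kraft) auto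
  finally show False by simp
qed

lemma selected_exists:
  assumes S: "allocation K W S" and x: "x \<notin> W" and W: "finite W" "[] \<in> W"
    and kraft: "\<And>F. finite F \<Longrightarrow> (\<Sum>x\<in>F. (1/2 :: real) ^ K x) \<le> 1"
  shows "\<exists>p. selected K x S p"
proof -
  define U where "U = {p \<in> S. usable K x p}"
  have U: "finite U" "U \<noteq> {}"
    using allocation_finite[OF S] usable_exists[OF assms] by (auto simp: U_def)
  define n where "n = Max (length ` snd ` U)"
  define V where "V = {p \<in> U. length (snd p) = n}"
  have n: "length (snd p) \<le> n" if "p \<in> U" for p
    using that U by (simp add: n_def)
  have "n \<in> length ` snd ` U" unfolding n_def using U by (intro Max_in) auto
  then obtain q where "q \<in> U" "length (snd q) = n" by auto
  then have "q \<in> V" by (simp add: V_def)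
  then have "V \<noteq> {}" by blast
  moreover have "finite V" unfolding V_def using U(1) by simp
  ultimately have V: "finite V" "V \<noteq> {}" by blast+
  define m where "m = Max (length ` fst ` V)"
  have "m \<in> length ` fst ` V" unfolding m_def using V by (intro Max_in) auto
  then obtain p where p: "p \<in> V" "length (fst p) = m" by auto
  have m: "length (fst q) \<le> m" if "q \<in> V" for q
    using that V by (simp add: m_def)
  have "length (snd q) < length (snd p) \<or> snd q = snd p \<and> length (fst q) \<le> length (fst p)"
    if "q \<in> S" "usable K x q" for q
  proof (cases "length (snd q) < n")
    case False
    then have q: "q \<in> V" using n[of q] that by (auto simp: V_def U_def)
    moreover have "prefix (snd q) x" "prefix (snd p) x"
      using p(1) that by (auto simp: V_def U_def usable_def split: prod.splits)
    \<comment> \<open>Both labels are prefixes of \<open>x\<close>, and equal length makes them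
      equal.\<close>
    ultimately have "snd q = snd p"
      using p(1) by (metis (mono_tags, lifting) V_def mem_Collect_eq prefix_length_prefix prefix_order.antisym order_refl)
    then show ?thesis using m[OF q] p by simp
  qed (use p in \<open>simp add: V_def\<close>)
  then have "selected K x S p" using p by (auto simp: selected_def V_def U_def)
  then show ?thesis ..
qed

lemma trim_iff:
  "(c, v) \<in> trim K x (c0, w0) \<longleftrightarrow>
    (\<exists>j. c = c0 @ replicate j False @ [True] \<and> j < K x - length c0 \<and>
      offcut_label K x w0 (length c0 + j) v) \<or>
    c = c0 @ replicate (K x - length c0) False \<and> v = x"
  unfolding trim_def by auto

text \<open>The label is the longest string from \<open>w\<close> to \<open>x\<close> that is
  \<open>w\<close> or has \<open>K\<close> at most \<open>l\<close>; \<open>w\<close> itself is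
  always a candidate.\<close>

lemma offcut_label_ex:
  assumes "strict_prefix w x"
  shows "\<exists>v. offcut_label K x w l v"
proof -
  let ?P = "\<lambda>v. prefix w v \<and> prefix v x \<and> (v = w \<or> K v \<le> l)"
  have "?P w" using assms by simp
  moreover have "\<forall>v. ?P v \<longrightarrow> length v < Suc (length x)" by (auto dest: prefix_length_le)
  ultimately obtain v where v: "?P v" and max: "\<And>u. ?P u \<Longrightarrow> length u \<le> length v"
    using ex_has_greatest_nat[of ?P w length "Suc (length x)"] by blast
  have "l < K u" if "strict_prefix v u" "prefix u x" for u
  proof (rule ccontr)
    assume "\<not> l < K u"
    moreover have "prefix w u"
      using that(1) v by (auto simp: strict_prefix_def intro: prefix_order.order_trans)
    ultimately have "length u \<le> length v" using that by (intro max) simp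
    then show False using prefix_length_less[OF that(1)] by simp
  qed
  then show ?thesis using v by (auto simp: offcut_label_def)
qed

lemma offcut_label_unique:
  assumes "offcut_label K x w l v" "offcut_label K x w l u"
  shows "v = u"
proof (rule ccontr)
  assume "v \<noteq> u"
  have *: False if "strict_prefix v u" "offcut_label K x w l v" "offcut_label K x w l u" for u v
  proof -
    have "l < K u" using that by (auto simp: offcut_label_def)
    moreover have "u \<noteq> w" using that by (auto simp: offcut_label_def strict_prefix_def prefix_order.antisym)
    ultimately show False using that(3) by (auto simp: offcut_label_def)
  qed
  have "prefix v u \<or> prefix u v"
    using assms prefix_same_cases unfolding offcut_label_def by blast
  then show False using * assms \<open>v \<noteq> u\<close> by (auto simp: strict_prefix_def)
qed

lemma begins_replicate:
  "begins \<beta> (c @ replicate j False) \<longleftrightarrow> begins \<beta> c \<and> (\<forall>i<j. \<not> \<beta> (length c + i))"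
  by (auto simp: begins_append)

lemma begins_offcut:
  "begins \<beta> (c @ replicate j False @ [True]) \<longleftrightarrow>
    begins \<beta> c \<and> (\<forall>i<j. \<not> \<beta> (length c + i)) \<and> \<beta> (length c + j)"
  using begins_append[of \<beta> "c @ replicate j False" "[True]"] by (auto simp: begins_replicate)

lemma trim_prefix: "(c, v) \<in> trim K x (c0, w0) \<Longrightarrow> prefix c0 c"
  by (auto simp: trim_iff)

text \<open>The first one of \<open>\<beta>\<close> after \<open>c0\<close> decides which offcut
  contains it; without a one among the next \<open>K x - length c0\<close> bits it lies in the part
  of \<open>x\<close>.\<close>

lemma trim_ex:
  assumes "begins \<beta> c0" "strict_prefix w0 x"
  shows "\<exists>c v. (c, v) \<in> trim K x (c0, w0) \<and> begins \<beta> c"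
proof (cases "\<exists>i<K x - length c0. \<beta> (length c0 + i)")
  case True
  define j where "j = (LEAST i. \<beta> (length c0 + i))"
  obtain i where i: "i < K x - length c0" "\<beta> (length c0 + i)" using True by blast
  have j: "\<beta> (length c0 + j)" "j \<le> i" "\<And>i. i < j \<Longrightarrow> \<not> \<beta> (length c0 + i)"
    unfolding j_def using i by (auto intro: LeastI Least_le dest: not_less_Least)
  obtain v where "offcut_label K x w0 (length c0 + j) v"
    using offcut_label_ex[OF assms(2)] by blast
  then have "(c0 @ replicate j False @ [True], v) \<in> trim K x (c0, w0)"
    using i(1) j(2) by (auto simp: trim_iff)
  moreover have "begins \<beta> (c0 @ replicate j False @ [True])"
    using assms(1) j by (simp add: begins_offcut)
  ultimately show ?thesis by blast
next
  case False
  then have "begins \<beta> (c0 @ replicate (K x - length c0) False)"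
    using assms(1) by (auto simp: begins_replicate)
  then show ?thesis by (auto simp: trim_iff)
qed

lemma trim_unique:
  assumes "(c, v) \<in> trim K x (c0, w0)" "(d, u) \<in> trim K x (c0, w0)" "begins \<beta> c" "begins \<beta> d"
  shows "c = d \<and> v = u"
proof -
  have *: "j = i" if "begins \<beta> (c0 @ replicate j False @ [True])"
    "begins \<beta> (c0 @ replicate i False @ [True])" for i j
    using that by (metis begins_offcut linorder_neqE_nat)
  have **: False if "begins \<beta> (c0 @ replicate j False @ [True])"
    "begins \<beta> (c0 @ replicate n False)" "j < n" for j n
    using that by (simp add: begins_offcut begins_replicate)
  show ?thesis
    using assms(1,2) unfolding trim_iff
  proof (elim disjE exE conjE)
    fix j i
    assume c: "c = c0 @ replicate j False @ [True]" "d = c0 @ replicate i False @ [True]"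
      and o: "offcut_label K x w0 (length c0 + j) v" "offcut_label K x w0 (length c0 + i) u"
    have "j = i" using *[of j i] assms(3,4) by (simp only: c)
    then show ?thesis using c o offcut_label_unique by blast
  next
    fix j assume "c = c0 @ replicate j False @ [True]" "d = c0 @ replicate (K x - length c0) False"
      "j < K x - length c0"
    then have False using **[of j "K x - length c0"] assms(3,4) by simp
    then show ?thesis ..
  next
    fix j assume "d = c0 @ replicate j False @ [True]" "c = c0 @ replicate (K x - length c0) False"
      "j < K x - length c0"
    then have False using **[of j "K x - length c0"] assms(3,4) by simp
    then show ?thesis ..
  qed simp
qed

lemma trim_sum:
  assumes "strict_prefix w0 x" "length c0 \<le> K x"
  shows "finite (trim K x (c0, w0)) \<and>
    (\<Sum>p\<in>trim K x (c0, w0). (1/2 :: real) ^ length (fst p)) = (1/2) ^ length c0"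
proof -
  obtain lab where lab: "\<And>l. offcut_label K x w0 l (lab l)"
    using offcut_label_ex[OF assms(1)] by metis
  let ?n = "K x - length c0"
  define g where "g j = (c0 @ replicate j False @ [True], lab (length c0 + j))" for j
  have trim: "trim K x (c0, w0) = insert (c0 @ replicate ?n False, x) (g ` {..<?n})"
  proof -
    have "offcut_label K x w0 l v \<longleftrightarrow> v = lab l" for l v
      using lab offcut_label_unique by blast
    then show ?thesis unfolding trim_def g_def by auto
  qed
  have inj: "inj_on g {..<?n}"
  proof (rule inj_onI)
    fix i j assume "g i = g j"
    then have "length (fst (g i)) = length (fst (g j))" by simp
    then show "i = j" by (simp add: g_def)
  qed
  have notin: "(c0 @ replicate ?n False, x) \<notin> g ` {..<?n}"
  proof
    assume "(c0 @ replicate ?n False, x) \<in> g ` {..<?n}"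
    then obtain j where "c0 @ replicate ?n False = c0 @ replicate j False @ [True]"
      by (auto simp: g_def)
    then have "replicate ?n False = replicate j False @ [True]" by simp
    then have eq: "replicate j False @ [True] = replicate ?n False" by (rule sym)
    have "True \<in> set (replicate j False @ [True])" by simp
    then have "True \<in> set (replicate ?n False)" by (simp only: eq)
    then show False by simp
  qed
  have geom: "(\<Sum>j<n. (1/2 :: real) ^ (l + Suc j)) + (1/2) ^ (l + n) = (1/2) ^ l" for l n
    by (induction n) simp_all
  have "(\<Sum>p\<in>trim K x (c0, w0). (1/2 :: real) ^ length (fst p)) =
      (1/2) ^ (length c0 + ?n) + (\<Sum>j<?n. (1/2) ^ (length c0 + Suc j))"
  proof -
    have "(\<Sum>p\<in>g ` {..<?n}. (1/2 :: real) ^ length (fst p)) =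
        (\<Sum>j<?n. (1/2) ^ (length c0 + Suc j))"
      by (simp add: sum.reindex[OF inj]) (simp add: g_def)
    then show ?thesis unfolding trim using notin by simp
  qed
  also have "\<dots> = (1/2) ^ length c0" using geom[where n = ?n and l = "length c0"] by (simp add: add.commute)
  finally show ?thesis by (simp add: trim)
qed

lemma selected_unique:
  assumes "allocation K W S" "selected K x S p" "selected K x S q"
  shows "p = q"
proof -
  have "snd p = snd q" "length (fst p) = length (fst q)"
    using assms(2,3) unfolding selected_def by (metis less_asym less_irrefl le_antisym)+
  moreover have "(fst p, snd p) \<in> S" "(fst q, snd q) \<in> S"
    using assms(2,3) by (auto simp: selected_def)
  ultimately have "fst p = fst q" using allocation_length[OF assms(1)] by metis
  then show ?thesis using \<open>snd p = snd q\<close> by (rule prod_eqI)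
qed

lemma refine_eq:
  assumes "allocation K W S" "selected K x S p"
  shows "refine K x S = (S - {p}) \<union> trim K x p"
proof -
  have "selected K x S q \<longleftrightarrow> q = p" for q using selected_unique[OF assms(1,2)] assms(2) by metis
  moreover have "p \<in> S" using assms(2) by (simp add: selected_def)
  ultimately show ?thesis unfolding refine_def by auto
qed

lemma trim_labels:
  assumes "(c, v) \<in> trim K x (c0, w0)" "usable K x (c0, w0)"
  shows "prefix w0 v \<and> prefix v x"
  using assms by (auto simp: trim_iff offcut_label_def usable_def)

text \<open>Offcuts are usable for \<open>x\<close>, and hence differ in length from the unselected pieces
  with their label.\<close>

lemma trim_offcut:
  assumes "(c, v) \<in> trim K x (c0, w0)" "v \<noteq> x"
  shows "length c0 < length c" "usable K x (c, v)" "v = w0 \<or> K v < length c"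
  using assms by (auto simp: trim_iff offcut_label_def usable_def strict_prefix_def Suc_le_eq)

text \<open>An offcut labelled \<open>x\<close> would need \<open>K x \<le> l\<close>, but every
  offcut has \<open>l < K x\<close>.\<close>

lemma trim_last:
  assumes "(c, x) \<in> trim K x (c0, w0)" "strict_prefix w0 x"
  shows "c = c0 @ replicate (K x - length c0) False"
  using assms by (auto simp: trim_iff offcut_label_def)

lemma refine_allocation:
  assumes S: "allocation K W S" and x: "x \<notin> W" and W: "\<And>w. strict_prefix w x \<Longrightarrow> w \<in> W"
    and sel: "selected K x S (c0, w0)"
  shows "allocation K (insert x W) (refine K x S)"
proof -
  have p: "(c0, w0) \<in> S" and us: "usable K x (c0, w0)"
    and max: "\<And>c w. (c, w) \<in> S \<Longrightarrow> usable K x (c, w) \<Longrightarrow>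
      length w < length w0 \<or> w = w0 \<and> length c \<le> length c0"
    using sel by (auto simp: selected_def)
  have w0: "strict_prefix w0 x" and c0: "length c0 \<le> K x"
    using us by (auto simp: usable_def)
  let ?C = "trim K x (c0, w0)"
  have R: "refine K x S = (S - {(c0, w0)}) \<union> ?C" by (rule refine_eq[OF S sel])
  note fin = allocation_finite[OF S]
  have C: "finite ?C" "(\<Sum>p\<in>?C. (1/2 :: real) ^ length (fst p)) = (1/2) ^ length c0"
    using trim_sum[of w0 x c0 K] w0 c0 by auto
  have not_x: "w \<noteq> x" if "(c, w) \<in> S" for c w using allocation_labels[OF S that] x by auto
  have lab: "v \<in> insert x W" if "(c, v) \<in> ?C" for c v
    using trim_labels[OF that us] W by (auto simp: strict_prefix_def)
  have split: "(c, v) \<in> refine K x S \<longleftrightarrow> (c, v) \<in> S \<and> (c, v) \<noteq> (c0, w0) \<or> (c, v) \<in> ?C" for c v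
    unfolding R by auto
  have only_x: "c = c0 @ replicate (K x - length c0) False" if "(c, x) \<in> refine K x S" for c
    using that not_x w0 unfolding split by (auto dest: trim_last)
  \<comment> \<open>An old piece as long as an offcut with its label would be usable for
    \<open>x\<close>. Its label is no shorter than \<open>w0\<close>, so the selection of
    \<open>(c0, w0)\<close> leaves only \<open>length c \<le> length c0\<close>, whereas offcuts are
    longer than \<open>c0\<close>.\<close>
  have old_new: "length c \<noteq> length d" if "(c, v) \<in> S" "(d, v) \<in> ?C" "(c, v) \<noteq> (c0, w0)" "v \<noteq> x" for c d v
  proof
    assume eq: "length c = length d"
    have "usable K x (c, v)" using trim_offcut(2)[OF that(2,4)] eq by (simp add: usable_def)
    moreover have "prefix w0 v" using trim_labels[OF that(2) us] by blast
    ultimately have "length c \<le> length c0"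
      using max[OF that(1)] prefix_length_le[of w0 v] by auto
    then show False using trim_offcut(1)[OF that(2,4)] eq by simp
  qed
  show ?thesis
    unfolding allocation_def
  proof (intro conjI allI impI)
    show "finite (refine K x S)" using fin C by (simp add: R)
    show "snd ` refine K x S \<subseteq> insert x W"
    proof
      fix w assume "w \<in> snd ` refine K x S"
      then obtain c where "(c, w) \<in> refine K x S" by force
      then show "w \<in> insert x W" using lab allocation_labels[OF S] unfolding split by blast
    qed
    show "\<exists>!p. p \<in> refine K x S \<and> begins \<beta> (fst p)" for \<beta>
    proof (rule ex_ex1I)
      obtain c w where cw: "(c, w) \<in> S" "begins \<beta> c" using allocation_ex[OF S] by blast
      show "\<exists>p. p \<in> refine K x S \<and> begins \<beta> (fst p)"
      proof (cases "(c, w) = (c0, w0)")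
        case True
        then have "begins \<beta> c0" using cw(2) by simp
        from trim_ex[OF this w0] obtain d v where "(d, v) \<in> ?C" "begins \<beta> d" by blast
        then show ?thesis by (intro exI[of _ "(d, v)"]) (simp add: split)
      qed (use cw in \<open>auto simp: split intro!: exI[of _ "(c, w)"]\<close>)
      have *: False if "(c, v) \<in> S" "(c, v) \<noteq> (c0, w0)" "begins \<beta> c" "(d, u) \<in> ?C" "begins \<beta> d" for c v d u
        using allocation_unique[OF S that(1) p that(3) begins_prefix[OF trim_prefix[OF that(4)] that(5)]] that(2)
        by simp
      show "p = q" if "p \<in> refine K x S \<and> begins \<beta> (fst p)" "q \<in> refine K x S \<and> begins \<beta> (fst q)" for p q
      proof -
        obtain c v d u where pq: "p = (c, v)" "q = (d, u)" by (cases p, cases q)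
        have b: "begins \<beta> c" "begins \<beta> d" "(c, v) \<in> refine K x S" "(d, u) \<in> refine K x S"
          using that by (auto simp: pq)
        have "c = d \<and> v = u"
          using b(3,4) unfolding split
        proof (elim disjE conjE)
          show ?thesis if "(c, v) \<in> S" "(d, u) \<in> S" using allocation_unique[OF S that b(1,2)] .
          show ?thesis if "(c, v) \<in> ?C" "(d, u) \<in> ?C" using trim_unique[OF that b(1,2)] .
          show ?thesis if "(c, v) \<in> S" "(c, v) \<noteq> (c0, w0)" "(d, u) \<in> ?C"
            using *[OF that(1,2) b(1) that(3) b(2)] ..
          show ?thesis if "(d, u) \<in> S" "(d, u) \<noteq> (c0, w0)" "(c, v) \<in> ?C"
            using *[OF that(1,2) b(2) that(3) b(1)] ..
        qed
        then show ?thesis by (simp add: pq)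
      qed
    qed
    show "(\<Sum>p\<in>refine K x S. (1/2 :: real) ^ length (fst p)) = 1"
    proof -
      have "(S - {(c0, w0)}) \<inter> ?C = {}"
      proof (rule ccontr)
        assume "\<not> ?thesis"
        then obtain c v where cv: "(c, v) \<in> S" "(c, v) \<noteq> (c0, w0)" "(c, v) \<in> ?C" by auto
        then have "v \<noteq> x" using not_x by blast
        then show False using old_new[OF cv(1,3,2)] by simp
      qed
      then have "(\<Sum>p\<in>refine K x S. (1/2 :: real) ^ length (fst p)) =
          (\<Sum>p\<in>S - {(c0, w0)}. (1/2) ^ length (fst p)) + (\<Sum>p\<in>?C. (1/2) ^ length (fst p))"
        unfolding R using fin C by (intro sum.union_disjoint) auto
      also have "\<dots> = 1"
        using allocation_sum[OF S] sum.remove[OF fin p, of "\<lambda>p. (1/2 :: real) ^ length (fst p)"]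
          C by simp
      finally show ?thesis .
    qed
    show "c = d" if "(c, w) \<in> refine K x S" "(d, w) \<in> refine K x S" "length c = length d" for c d w
    proof (cases "w = x")
      case True
      then show ?thesis using only_x that by blast
    next
      case False
      have CC: "c = d" if "(c, w) \<in> ?C" "(d, w) \<in> ?C" "length c = length d" for c d
        using that False by (auto simp: trim_iff)
      show ?thesis
        using that(1,2) unfolding split
      proof (elim disjE conjE)
        show ?thesis if "(c, w) \<in> S" "(d, w) \<in> S"
          using allocation_length[OF S that] \<open>length c = length d\<close> by blast
        show ?thesis if "(c, w) \<in> S" "(c, w) \<noteq> (c0, w0)" "(d, w) \<in> ?C"
          using old_new[OF that(1,3,2) False] \<open>length c = length d\<close> by blast
        show ?thesis if "(d, w) \<in> S" "(d, w) \<noteq> (c0, w0)" "(c, w) \<in> ?C"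
          using old_new[OF that(1,3,2) False] \<open>length c = length d\<close> by simp
        show ?thesis if "(c, w) \<in> ?C" "(d, w) \<in> ?C"
          using CC[OF that \<open>length c = length d\<close>] .
      qed
    qed
    \<comment> \<open>Either the offcut is a proper part of \<open>c0\<close>, already labelled
      \<open>w\<close>, or \<open>K w \<le> l\<close> while its length is
      \<open>l + 1\<close>.\<close>
    have new: "K w < length c" if "(c, w) \<in> ?C" "w \<noteq> x" "w \<noteq> []" for c w
      using trim_offcut(3)[OF that(1,2)]
    proof
      assume "w = w0"
      then have "K w \<le> length c0" using allocation_ge[OF S p] that(3) by simp
      then show ?thesis using trim_offcut(1)[OF that(1,2)] by simp
    qed
    show "K w \<le> length c" if "(c, w) \<in> refine K x S" "w \<noteq> []" for c w
    proof (cases "w = x")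
      case True
      then have "c = c0 @ replicate (K x - length c0) False" using only_x that(1) by simp
      then show ?thesis using True c0 by simp
    next
      case False
      show ?thesis
        using that(1) unfolding split
      proof (elim disjE conjE)
        show ?thesis if "(c, w) \<in> S" using allocation_ge[OF S that \<open>w \<noteq> []\<close>] .
        show ?thesis if "(c, w) \<in> ?C" using new[OF that False \<open>w \<noteq> []\<close>] by simp
      qed
    qed
    show "c = d" if "(c, w) \<in> refine K x S" "(d, w) \<in> refine K x S" "w \<noteq> []" "length c = K w" for c d w
    proof (cases "w = x")
      case True
      then show ?thesis using only_x that by blast
    next
      case False
      have "(c, w) \<notin> ?C" using new[OF _ False that(3)] that(4) by (metis less_irrefl)
      then have cS: "(c, w) \<in> S" "(c, w) \<noteq> (c0, w0)"
        using that(1) unfolding split by blast+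
      \<comment> \<open>An offcut \<open>d\<close> labelled \<open>w\<close> would be longer than
        \<open>c\<close>, so \<open>c\<close> would be usable, and the selection would force
        \<open>w = w0\<close>. But a cylinder of length \<open>K w\<close> is alone with its label,
        which makes \<open>c\<close> equal to \<open>c0\<close>.\<close>
      have "(d, w) \<notin> ?C"
      proof
        assume C: "(d, w) \<in> ?C"
        have "length c \<le> length d" using new[OF C False that(3)] that(4) by simp
        then have "usable K x (c, w)"
          using trim_offcut(2)[OF C False] order.trans unfolding usable_def prod.case by blast
        moreover have "prefix w0 w" using trim_labels[OF C us] by blast
        ultimately have "w = w0"
          using max[OF cS(1)] prefix_length_le[of w0 w] by auto
        then show False using allocation_eq[OF S cS(1) _ \<open>w \<noteq> []\<close> that(4), of c0] p cS(2) by blast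
      qed
      then have "(d, w) \<in> S" using that(2) unfolding split by blast
      then show ?thesis using allocation_eq[OF S cS(1) _ that(3,4)] by blast
    qed
  qed
qed

lemma refine_mono:
  assumes S: "allocation K W S" and sel: "selected K x S (c0, w0)"
    and old: "(c, w) \<in> S" "begins \<beta> c" and new: "(d, v) \<in> refine K x S" "begins \<beta> d"
  shows "prefix c d \<and> prefix w v"
proof (cases "(d, v) \<in> S")
  case True
  then show ?thesis using allocation_unique[OF S old(1) True old(2) new(2)] by simp
next
  case False
  then have C: "(d, v) \<in> trim K x (c0, w0)" using new(1) refine_eq[OF S sel] by auto
  have p: "(c0, w0) \<in> S" "usable K x (c0, w0)" using sel by (auto simp: selected_def)
  have "begins \<beta> c0" using begins_prefix[OF trim_prefix[OF C] new(2)] .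
  then have "c = c0 \<and> w = w0" using allocation_unique[OF S old(1) p(1) old(2)] by blast
  then show ?thesis using trim_prefix[OF C] trim_labels[OF C p(2)] by blast
qed

text \<open>Whatever becomes part of the output comes in whole cylinders no longer than \<open>K\<close> allows;
  this is what bounds the oracle use.\<close>

lemma refine_granule:
  assumes S: "allocation K W S" and sel: "selected K x S (c0, w0)"
    and old: "(c, w) \<in> S" "begins \<beta> c" and new: "(d, v) \<in> refine K x S" "begins \<beta> d"
    and y: "prefix y v" "\<not> prefix y w"
  shows "\<exists>g. prefix c g \<and> begins \<beta> g \<and> length g \<le> K y \<and>
    (\<forall>\<gamma> e u. begins \<gamma> g \<longrightarrow> (e, u) \<in> refine K x S \<longrightarrow> begins \<gamma> e \<longrightarrow> prefix y u)"
proof -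
  have R: "refine K x S = (S - {(c0, w0)}) \<union> trim K x (c0, w0)" by (rule refine_eq[OF S sel])
  have p: "(c0, w0) \<in> S" and us: "usable K x (c0, w0)" using sel by (auto simp: selected_def)
  have C: "(d, v) \<in> trim K x (c0, w0)"
  proof (rule ccontr)
    assume "\<not> ?thesis"
    then have "(d, v) \<in> S" using new(1) R by auto
    then show False using allocation_unique[OF S old(1) _ old(2) new(2)] y by blast
  qed
  have "begins \<beta> c0" using begins_prefix[OF trim_prefix[OF C] new(2)] .
  then have cw: "c = c0" "w = w0" using allocation_unique[OF S old(1) p old(2)] by auto
  have v: "prefix w0 v" "prefix v x" using trim_labels[OF C us] by auto
  have "prefix w0 y" "w0 \<noteq> y" using prefix_same_cases[OF v(1) y(1)] y(2) cw by auto
  then have w0y: "strict_prefix w0 y" by (simp add: strict_prefix_def)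
  have yx: "prefix y x" using y(1) v(2) prefix_order.order_trans by blast
  \<comment> \<open>The cheapest string from \<open>y\<close> to \<open>x\<close> determines the
    granule: offcuts with \<open>l \<ge> K u0\<close> are labelled by extensions of
    \<open>u0\<close>, hence of \<open>y\<close>, so the subcylinder of length \<open>K u0\<close>
    goes to extensions of \<open>y\<close> as a whole.\<close>
  obtain u0 where u0: "prefix y u0" "prefix u0 x"
    and min: "\<And>u. prefix y u \<Longrightarrow> prefix u x \<Longrightarrow> K u0 \<le> K u"
    using ex_has_least_nat[of "\<lambda>u. prefix y u \<and> prefix u x" x K] yx by auto
  have "strict_prefix w0 u0" using w0y u0(1) by (rule prefix_order.less_le_trans)
  then have c0: "length c0 \<le> K u0" using us u0 by (auto simp: usable_def)
  define i where "i = K u0 - length c0"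
  define g where "g = c0 @ replicate i False"
  have ix: "i \<le> K x - length c0" using min[OF yx] unfolding i_def by simp
  have g_begins: "begins \<gamma> g \<longleftrightarrow> begins \<gamma> c0 \<and> (\<forall>j<i. \<not> \<gamma> (length c0 + j))" for \<gamma>
    by (simp add: g_def begins_replicate)
  have "begins \<beta> g"
    using C unfolding trim_iff
  proof (elim disjE exE conjE)
    fix j assume j: "d = c0 @ replicate j False @ [True]" "offcut_label K x w0 (length c0 + j) v"
    have "v \<noteq> w0" using y cw by auto
    then have "K u0 \<le> length c0 + j"
      using j(2) min[OF y(1) v(2)] by (auto simp: offcut_label_def)
    then have "i \<le> j" by (simp add: i_def)
    then show ?thesis using new(2) j(1) by (auto simp: g_begins begins_offcut)
  next
    assume "d = c0 @ replicate (K x - length c0) False"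
    then show ?thesis using new(2) ix by (auto simp: g_begins begins_replicate)
  qed
  moreover have "length g \<le> K y" using c0 min[OF _ yx] by (simp add: g_def i_def)
  moreover have "prefix y u" if g: "begins \<gamma> g" and e: "(e, u) \<in> refine K x S" "begins \<gamma> e" for \<gamma> e u
  proof -
    have \<gamma>: "begins \<gamma> c0" using g by (simp add: g_begins)
    have "(e, u) \<in> trim K x (c0, w0)"
    proof (rule ccontr)
      assume "\<not> ?thesis"
      then have "(e, u) \<in> S" "(e, u) \<noteq> (c0, w0)" using e(1) R by auto
      then show False using allocation_unique[OF S p _ \<gamma> e(2)] by blast
    qed
    then show ?thesis
      unfolding trim_iff
    proof (elim disjE exE conjE)
      fix j assume j: "e = c0 @ replicate j False @ [True]" "offcut_label K x w0 (length c0 + j) u"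
      have "i \<le> j"
        using e(2) g by (metis begins_offcut g_begins j(1) not_le)
      then have "K u0 \<le> length c0 + j" by (simp add: i_def)
      then have "\<not> strict_prefix u u0" using j(2) u0(2) by (auto simp: offcut_label_def not_less)
      moreover have "prefix u u0 \<or> prefix u0 u"
        using j(2) u0(2) prefix_same_cases unfolding offcut_label_def by blast
      ultimately have "prefix u0 u" by (auto simp: strict_prefix_def)
      then show ?thesis using u0(1) prefix_order.order_trans by blast
    qed (use yx in simp)
  qed
  ultimately show ?thesis using cw by (intro exI[of _ g]) (auto simp: g_def)
qed

section \<open>The oracle and the run of the machine\<close>

declare dec.simps(2) [simp del]

lemma enc_less_enc: "strict_prefix u v \<Longrightarrow> enc u < enc v"
proof (induction v rule: rev_induct)
  case (snoc b v)
  then have "u = v \<or> strict_prefix u v" by (auto simp: strict_prefix_def)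
  then show ?case using snoc.IH by (auto simp: enc_snoc)
qed simp

lemma restr_Suc: "\<alpha> \<restriction> Suc n = \<alpha> \<restriction> n @ [\<alpha> n]"
  by (simp add: restr_def)

lemma prefix_restr: "m \<le> n \<Longrightarrow> prefix (\<alpha> \<restriction> m) (\<alpha> \<restriction> n)"
  using begins_comparable[of \<alpha> "\<alpha> \<restriction> m" "\<alpha> \<restriction> n"] by simp

primrec stage :: "(bool list \<Rightarrow> nat) \<Rightarrow> nat \<Rightarrow> piece set" where
  "stage K 0 = {([], [])}"
| "stage K (Suc m) = refine K (dec (Suc m)) (stage K m)"

text \<open>In this case a single piece of the stage meets \<open>\<sigma>\<close>, and reading on
  would not narrow down the label at this stage.\<close>

definition covered :: "(bool list \<Rightarrow> nat) \<Rightarrow> nat \<Rightarrow> bool list \<Rightarrow> bool" where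
  "covered K m \<sigma> \<longleftrightarrow> (\<exists>(c, w)\<in>stage K m. prefix c \<sigma>)"

definition writable :: "(bool list \<Rightarrow> nat) \<Rightarrow> nat \<Rightarrow> bool list \<Rightarrow> bool list \<Rightarrow> bool" where
  "writable K m \<sigma> y \<longleftrightarrow> (\<forall>(c, w)\<in>stage K m. prefix c \<sigma> \<or> prefix \<sigma> c \<longrightarrow> prefix y w)"

text \<open>The oracle bits read and the output written after \<open>m\<close> rounds.\<close>

primrec trace :: "(bool list \<Rightarrow> nat) \<Rightarrow> bitseq \<Rightarrow> nat \<Rightarrow> bool list \<times> bool list" where
  "trace K \<beta> 0 = ([], [])"
| "trace K \<beta> (Suc m) = (let (\<sigma>, x) = trace K \<beta> m in
    if writable K m \<sigma> (x @ [False]) then (\<sigma>, x @ [False])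
    else if writable K m \<sigma> (x @ [True]) then (\<sigma>, x @ [True])
    else if covered K m \<sigma> then (\<sigma>, x)
    else (\<sigma> @ [\<beta> (length \<sigma>)], x))"

definition reaches :: "(bool list \<Rightarrow> nat) \<Rightarrow> bitseq \<Rightarrow> bool list \<Rightarrow> bool" where
  "reaches K \<beta> y \<longleftrightarrow> (\<exists>m c w. (c, w) \<in> stage K m \<and> begins \<beta> c \<and> prefix y w)"

text \<open>Only finite parts of the Kraft series enter the combinatorics.\<close>

locale kraft =
  fixes K :: "bool list \<Rightarrow> nat"
  assumes kraft: "finite F \<Longrightarrow> (\<Sum>x\<in>F. (1/2 :: real) ^ K x) \<le> 1"
begin

text \<open>Stated for an arbitrary allocation because the induction for
  \<open>stage_allocation\<close> uses it on the way.\<close>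

lemma selected_ex:
  assumes "allocation K (dec ` {..m}) S"
  shows "\<exists>c0 w0. selected K (dec (Suc m)) S (c0, w0)"
proof -
  have "[] \<in> dec ` {..m}" by (rule image_eqI[of _ _ 0]) simp_all
  moreover have "dec (Suc m) \<notin> dec ` {..m}" by auto
  ultimately have "\<exists>p. selected K (dec (Suc m)) S p"
    by (intro selected_exists[OF assms] kraft) simp_all
  then show ?thesis by simp
qed

lemma stage_allocation: "allocation K (dec ` {..m}) (stage K m)"
proof (induction m)
  case 0
  show ?case by (auto simp: allocation_def)
next
  case (Suc m)
  obtain c0 w0 where sel: "selected K (dec (Suc m)) (stage K m) (c0, w0)"
    using selected_ex[OF Suc] by blast
  have "allocation K (insert (dec (Suc m)) (dec ` {..m})) (stage K (Suc m))"
    unfolding stage.simps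
  proof (rule refine_allocation[OF Suc _ _ sel])
    show "dec (Suc m) \<notin> dec ` {..m}" by auto
    show "w \<in> dec ` {..m}" if "strict_prefix w (dec (Suc m))" for w
    proof (rule image_eqI)
      show "w = dec (enc w)" by simp
      show "enc w \<in> {..m}" using enc_less_enc[OF that] by simp
    qed
  qed
  then show ?case by (simp only: atMost_Suc image_insert)
qed

lemma stage_selected: "\<exists>c0 w0. selected K (dec (Suc m)) (stage K m) (c0, w0)"
  by (rule selected_ex[OF stage_allocation])

lemma stage_ex: "\<exists>c w. (c, w) \<in> stage K m \<and> begins \<beta> c"
  by (rule allocation_ex[OF stage_allocation])

lemma stage_mono:
  assumes "m \<le> n" "(c, w) \<in> stage K m" "begins \<beta> c" "(d, v) \<in> stage K n" "begins \<beta> d"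
  shows "prefix c d \<and> prefix w v"
  using assms(1,4,5)
proof (induction n arbitrary: d v rule: dec_induct)
  case base
  then show ?case using allocation_unique[OF stage_allocation assms(2) base(1) assms(3)] by auto
next
  case (step n)
  obtain e u where e: "(e, u) \<in> stage K n" "begins \<beta> e" using stage_ex by blast
  obtain c0 w0 where sel: "selected K (dec (Suc n)) (stage K n) (c0, w0)"
    using stage_selected by blast
  have "prefix e d \<and> prefix u v"
    using refine_mono[OF stage_allocation sel e] step.prems by simp
  moreover have "prefix c e \<and> prefix w u" using step.IH e by blast
  ultimately show ?case using prefix_order.order_trans by blast
qed

text \<open>The granule arises at the first stage whose label around \<open>\<beta>\<close> extends
  \<open>y\<close>. Its position inside one piece \<open>c\<close> of the preceding stage is what
  later allows an appeal to \<open>covered\<close>.\<close>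

lemma reaches_granule:
  assumes "reaches K \<beta> y" "y \<noteq> []"
  obtains m c w g where "(c, w) \<in> stage K m" "prefix c g" "begins \<beta> g" "length g \<le> K y"
    "\<And>\<gamma> e u. begins \<gamma> g \<Longrightarrow> (e, u) \<in> stage K (Suc m) \<Longrightarrow> begins \<gamma> e \<Longrightarrow> prefix y u"
proof -
  define P where "P m \<longleftrightarrow> (\<exists>c w. (c, w) \<in> stage K m \<and> begins \<beta> c \<and> prefix y w)" for m
  have "\<exists>m. P m" using assms(1) by (simp add: reaches_def P_def)
  then obtain n where n: "P n" "\<And>m. m < n \<Longrightarrow> \<not> P m" using exists_least_iff[of P] by blast
  have "n \<noteq> 0"
  proof
    assume "n = 0"
    then show False using n(1) assms(2) by (simp add: P_def)
  qed
  then obtain m where m: "n = Suc m" by (cases n) auto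
  obtain d v where d: "(d, v) \<in> stage K (Suc m)" "begins \<beta> d" "prefix y v"
    using n(1) unfolding P_def m by blast
  obtain c w where c: "(c, w) \<in> stage K m" "begins \<beta> c" using stage_ex by blast
  have "\<not> prefix y w" using n(2)[of m] c unfolding P_def m by blast
  obtain c0 w0 where sel: "selected K (dec (Suc m)) (stage K m) (c0, w0)"
    using stage_selected by blast
  obtain g where "prefix c g" "begins \<beta> g" "length g \<le> K y"
    "\<And>\<gamma> e u. begins \<gamma> g \<Longrightarrow> (e, u) \<in> stage K (Suc m) \<Longrightarrow> begins \<gamma> e \<Longrightarrow> prefix y u"
    using refine_granule[OF stage_allocation sel c d(1)[unfolded stage.simps] d(2,3) \<open>\<not> prefix y w\<close>]
    unfolding stage.simps by blast
  then show thesis using that c(1) by blast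
qed

lemma reaches_Nil: "reaches K \<beta> []"
  unfolding reaches_def by (rule exI[of _ 0]) simp

lemma reaches_prefix: "reaches K \<beta> y \<Longrightarrow> prefix z y \<Longrightarrow> reaches K \<beta> z"
  unfolding reaches_def using prefix_order.order_trans by blast

lemma reaches_ex: "\<exists>\<beta>. reaches K \<beta> y"
proof (cases "enc y")
  case 0
  then have "y = []" by (metis dec.simps(1) dec_enc)
  then show ?thesis using reaches_Nil by blast
next
  case (Suc m)
  then have y: "y = dec (Suc m)" by (metis dec_enc)
  obtain c0 w0 where sel: "selected K (dec (Suc m)) (stage K m) (c0, w0)"
    using stage_selected by blast
  define c where "c = c0 @ replicate (K y - length c0) False"
  have "stage K (Suc m) = stage K m - {(c0, w0)} \<union> trim K y (c0, w0)"
    using refine_eq[OF stage_allocation sel] by (simp add: y)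
  then have "(c, y) \<in> stage K (Suc m)" by (simp add: trim_iff c_def)
  moreover obtain \<beta> where "begins \<beta> c" using begins_ex by blast
  ultimately show ?thesis unfolding reaches_def by blast
qed

lemma reaches_comparable:
  assumes "reaches K \<beta> y" "reaches K \<beta> z"
  shows "prefix y z \<or> prefix z y"
proof -
  obtain m c w where m: "(c, w) \<in> stage K m" "begins \<beta> c" "prefix y w"
    using assms(1) unfolding reaches_def by blast
  obtain n d v where n: "(d, v) \<in> stage K n" "begins \<beta> d" "prefix z v"
    using assms(2) unfolding reaches_def by blast
  show ?thesis
  proof (cases "m \<le> n")
    case True
    then have "prefix w v" using stage_mono m n by blast
    then have "prefix y v" using m(3) prefix_order.order_trans by blast
    then show ?thesis using n(3) prefix_same_cases by blast
  next
    case False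
    then have "prefix v w" using stage_mono[of n m] m n by simp
    then have "prefix z w" using n(3) prefix_order.order_trans by blast
    then show ?thesis using m(3) prefix_same_cases by blast
  qed
qed

text \<open>Koenig's lemma; the limit reaches the prefixes of \<open>\<alpha>\<close> because each of them is reached
  on a union of cylinders of bounded length, that is, on a closed set.\<close>

lemma oracle_ex: "\<exists>\<beta>. \<forall>n. reaches K \<beta> (\<alpha> \<restriction> n)"
proof -
  define T where "T \<tau> \<longleftrightarrow> (\<forall>n. \<exists>\<gamma>. begins \<gamma> \<tau> \<and> reaches K \<gamma> (\<alpha> \<restriction> n))" for \<tau>
  have T_Nil: "T []" using reaches_ex by (simp add: T_def)
  have T_ext: "\<exists>b. T (\<tau> @ [b])" if T: "T \<tau>" for \<tau>
  proof (rule ccontr)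
    assume "\<not> ?thesis"
    then have "\<forall>b. \<exists>n. \<forall>\<gamma>. begins \<gamma> (\<tau> @ [b]) \<longrightarrow> \<not> reaches K \<gamma> (\<alpha> \<restriction> n)"
      unfolding T_def by blast
    then obtain N where N: "\<And>b \<gamma>. begins \<gamma> (\<tau> @ [b]) \<Longrightarrow> \<not> reaches K \<gamma> (\<alpha> \<restriction> N b)" by metis
    define n where "n = max (N True) (N False)"
    obtain \<gamma> where \<gamma>: "begins \<gamma> \<tau>" "reaches K \<gamma> (\<alpha> \<restriction> n)" using T unfolding T_def by blast
    have "begins \<gamma> (\<tau> @ [\<gamma> (length \<tau>)])" using \<gamma>(1) by (simp add: begins_append)
    then have "\<not> reaches K \<gamma> (\<alpha> \<restriction> N (\<gamma> (length \<tau>)))" by (rule N)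
    moreover have "N (\<gamma> (length \<tau>)) \<le> n" unfolding n_def by (cases "\<gamma> (length \<tau>)") auto
    ultimately show False using reaches_prefix[OF \<gamma>(2) prefix_restr] by blast
  qed
  define \<tau> where "\<tau> = rec_nat [] (\<lambda>n t. t @ [SOME b. T (t @ [b])])"
  define \<beta> where "\<beta> n = (SOME b. T (\<tau> n @ [b]))" for n
  have \<tau>_Suc: "\<tau> (Suc n) = \<tau> n @ [\<beta> n]" for n by (simp add: \<tau>_def \<beta>_def)
  have \<tau>: "\<tau> n = \<beta> \<restriction> n" for n
  proof (induction n)
    case 0
    show ?case by (simp add: \<tau>_def restr_def)
  next
    case (Suc n)
    then show ?case by (simp add: \<tau>_Suc restr_Suc)
  qed
  have T: "T (\<tau> n)" for n
  proof (induction n)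
    case 0
    show ?case using T_Nil by (simp add: \<tau>_def)
  next
    case (Suc n)
    then show ?case using someI_ex[OF T_ext[OF Suc]] by (simp add: \<tau>_Suc \<beta>_def)
  qed
  have "reaches K \<beta> (\<alpha> \<restriction> n)" for n
  proof (cases "\<alpha> \<restriction> n = []")
    case True
    then show ?thesis using reaches_Nil by simp
  next
    case False
    obtain \<gamma> where \<gamma>: "begins \<gamma> (\<tau> (K (\<alpha> \<restriction> n)))" "reaches K \<gamma> (\<alpha> \<restriction> n)"
      using T[of "K (\<alpha> \<restriction> n)"] unfolding T_def by blast
    obtain m c w g where g: "begins \<gamma> g" "length g \<le> K (\<alpha> \<restriction> n)"
      "\<And>\<gamma> e u. begins \<gamma> g \<Longrightarrow> (e, u) \<in> stage K (Suc m) \<Longrightarrow> begins \<gamma> e \<Longrightarrow> prefix (\<alpha> \<restriction> n) u"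
      using reaches_granule[OF \<gamma>(2) False] by metis
    \<comment> \<open>The granule is no longer than the common prefix of \<open>\<gamma>\<close> and
      \<open>\<beta>\<close>, so it contains \<open>\<beta>\<close> as well.\<close>
    have "prefix g (\<tau> (K (\<alpha> \<restriction> n)))" using begins_comparable[OF g(1) \<gamma>(1)] g(2) by (simp add: \<tau>)
    then have "begins \<beta> g" by (rule begins_prefix) (simp add: \<tau>)
    moreover obtain e u where e: "(e, u) \<in> stage K (Suc m)" "begins \<beta> e" using stage_ex by blast
    ultimately have "prefix (\<alpha> \<restriction> n) u" using g(3) by blast
    then show ?thesis using e unfolding reaches_def by blast
  qed
  then show ?thesis by blast
qed

section \<open>The run on an oracle that reaches every prefix of \<alpha>\<close>

context
  fixes \<alpha> \<beta> :: bitseq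
  assumes reach: "\<And>n. reaches K \<beta> (\<alpha> \<restriction> n)"
begin

lemma comparable_begins_ex: "prefix c d \<or> prefix d c \<Longrightarrow> \<exists>\<gamma>. begins \<gamma> c \<and> begins \<gamma> d"
  by (metis begins_ex begins_prefix)

text \<open>The piece around \<open>\<beta>\<close> meets \<open>\<sigma>\<close>, so
  \<open>\<beta>\<close> reaches every writable string; strings reached by one oracle are
  comparable, which leaves only the prefix of \<open>\<alpha>\<close>.\<close>

lemma writable_correct:
  assumes "begins \<beta> \<sigma>" "writable K m \<sigma> (\<alpha> \<restriction> k @ [b])"
  shows "\<alpha> \<restriction> k @ [b] = \<alpha> \<restriction> Suc k"
proof -
  obtain c w where c: "(c, w) \<in> stage K m" "begins \<beta> c" using stage_ex by blast
  have "prefix c \<sigma> \<or> prefix \<sigma> c"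
    using begins_comparable[OF c(2) assms(1)] begins_comparable[OF assms(1) c(2)] by linarith
  then have "prefix (\<alpha> \<restriction> k @ [b]) w" using assms(2) c(1) unfolding writable_def by blast
  then have "reaches K \<beta> (\<alpha> \<restriction> k @ [b])" using c unfolding reaches_def by blast
  from reaches_comparable[OF this reach[of "Suc k"]] show ?thesis
    by (auto simp: prefix_def restr_Suc)
qed

text \<open>Otherwise \<open>\<sigma>\<close> would extend the granule of
  \<open>\<alpha> \<restriction> n\<close>. From the stage that creates the granule on, the next bit
  is writable; before that, the piece containing the granule covers \<open>\<sigma>\<close>. All
  \<open>n > k\<close> are treated because a bit read now counts for every later prefix and
  \<open>K\<close> is not monotone.\<close>

lemma read_length:
  assumes "begins \<beta> \<sigma>" "\<not> writable K m \<sigma> (\<alpha> \<restriction> Suc k)" "\<not> covered K m \<sigma>" "k < n"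
  shows "length \<sigma> < K (\<alpha> \<restriction> n)"
proof (rule ccontr)
  assume "\<not> ?thesis"
  then have len: "K (\<alpha> \<restriction> n) \<le> length \<sigma>" by simp
  have "\<alpha> \<restriction> n \<noteq> []" using assms(4) by (auto simp: restr_def)
  from reaches_granule[OF reach this] obtain s c w g where c: "(c, w) \<in> stage K s" "prefix c g"
    and g: "begins \<beta> g" "length g \<le> K (\<alpha> \<restriction> n)"
    "\<And>\<gamma> e u. begins \<gamma> g \<Longrightarrow> (e, u) \<in> stage K (Suc s) \<Longrightarrow> begins \<gamma> e \<Longrightarrow> prefix (\<alpha> \<restriction> n) u"
    by metis
  have g\<sigma>: "prefix g \<sigma>" using begins_comparable[OF g(1) assms(1)] g(2) len by simp
  show False
  proof (cases "Suc s \<le> m")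
    case True
    have "prefix (\<alpha> \<restriction> Suc k) v" if d: "(d, v) \<in> stage K m" "prefix d \<sigma> \<or> prefix \<sigma> d" for d v
    proof -
      obtain \<gamma> where \<gamma>: "begins \<gamma> d" "begins \<gamma> \<sigma>" using comparable_begins_ex[OF d(2)] by blast
      obtain e u where e: "(e, u) \<in> stage K (Suc s)" "begins \<gamma> e" using stage_ex by blast
      have "prefix (\<alpha> \<restriction> n) u" using g(3)[OF begins_prefix[OF g\<sigma> \<gamma>(2)] e] .
      moreover have "prefix u v" using stage_mono[OF True e d(1) \<gamma>(1)] by blast
      moreover have "prefix (\<alpha> \<restriction> Suc k) (\<alpha> \<restriction> n)" using assms(4) by (intro prefix_restr) simp
      ultimately show ?thesis using prefix_order.order_trans by blast
    qed
    then show False using assms(2) unfolding writable_def by blast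
  next
    case False
    obtain d v where d: "(d, v) \<in> stage K m" "begins \<beta> d" using stage_ex by blast
    have "prefix d c" using stage_mono[OF _ d c(1) begins_prefix[OF c(2) g(1)]] False by simp
    then have "prefix d \<sigma>" using c(2) g\<sigma> prefix_order.order_trans by blast
    then show False using d(1) assms(3) unfolding covered_def by blast
  qed
qed

text \<open>A covered \<open>\<sigma>\<close> meets just one piece, the one around
  \<open>\<beta>\<close>, and the label there only grows with the stages.\<close>

lemma covered_writable:
  assumes "begins \<beta> \<sigma>" "covered K m \<sigma>" "(c, w) \<in> stage K s" "begins \<beta> c" "prefix y w" "s \<le> m"
  shows "writable K m \<sigma> y"
proof -
  obtain d v where d: "(d, v) \<in> stage K m" "prefix d \<sigma>" using assms(2) unfolding covered_def by blast
  have "prefix w v" using stage_mono[OF assms(6,3,4) d(1) begins_prefix[OF d(2) assms(1)]] by blast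
  then have v: "prefix y v" using assms(5) prefix_order.order_trans by blast
  have "prefix y u" if e: "(e, u) \<in> stage K m" "prefix e \<sigma> \<or> prefix \<sigma> e" for e u
  proof -
    obtain \<gamma> where \<gamma>: "begins \<gamma> e" "begins \<gamma> \<sigma>" using comparable_begins_ex[OF e(2)] by blast
    have "d = e \<and> v = u"
      using allocation_unique[OF stage_allocation d(1) e(1) begins_prefix[OF d(2) \<gamma>(2)] \<gamma>(1)] .
    then show ?thesis using v by simp
  qed
  then show ?thesis unfolding writable_def by blast
qed

lemma trace_step:
  assumes "trace K \<beta> m = (\<sigma>, x)" "begins \<beta> \<sigma>" "x = \<alpha> \<restriction> k"
  shows "trace K \<beta> (Suc m) = (if writable K m \<sigma> (\<alpha> \<restriction> Suc k) then (\<sigma>, \<alpha> \<restriction> Suc k)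
    else if covered K m \<sigma> then (\<sigma>, x) else (\<sigma> @ [\<beta> (length \<sigma>)], x))"
proof -
  have "writable K m \<sigma> (x @ [b]) \<Longrightarrow> x @ [b] = \<alpha> \<restriction> Suc k" for b
    using writable_correct[OF assms(2)] assms(3) by simp
  moreover have "\<alpha> \<restriction> Suc k = x @ [\<alpha> k]" using assms(3) by (simp add: restr_Suc)
  ultimately show ?thesis
    using assms(1) by (cases "\<alpha> k") auto
qed

lemma trace_correct:
  assumes "trace K \<beta> m = (\<sigma>, x)"
  shows "begins \<beta> \<sigma> \<and> x = \<alpha> \<restriction> length x \<and> (\<forall>n>length x. length \<sigma> \<le> K (\<alpha> \<restriction> n))"
  using assms
proof (induction m arbitrary: \<sigma> x)
  case 0
  then show ?case by (simp add: restr_def)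
next
  case (Suc m)
  obtain \<sigma>' x' where tr: "trace K \<beta> m = (\<sigma>', x')" by fastforce
  have IH: "begins \<beta> \<sigma>'" "x' = \<alpha> \<restriction> length x'" "\<And>n. n > length x' \<Longrightarrow> length \<sigma>' \<le> K (\<alpha> \<restriction> n)"
    using Suc.IH[OF tr] by blast+
  note step = trace_step[OF tr IH(1,2)]
  consider "writable K m \<sigma>' (\<alpha> \<restriction> Suc (length x'))" "\<sigma> = \<sigma>'" "x = \<alpha> \<restriction> Suc (length x')"
    | "\<sigma> = \<sigma>'" "x = x'"
    | "\<not> writable K m \<sigma>' (\<alpha> \<restriction> Suc (length x'))" "\<not> covered K m \<sigma>'"
      "\<sigma> = \<sigma>' @ [\<beta> (length \<sigma>')]" "x = x'"
    using step Suc.prems by (auto split: if_splits)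
  then show ?case
  proof cases
    case 1
    then show ?thesis using IH by simp
  next
    case 2
    then show ?thesis using IH by blast
  next
    case 3
    have "begins \<beta> \<sigma>" using IH(1) 3(3) by (simp add: begins_append)
    moreover have "length \<sigma> \<le> K (\<alpha> \<restriction> n)" if "n > length x'" for n
      using read_length[OF IH(1) 3(1,2) that] 3(3) by simp
    ultimately show ?thesis using IH(2) 3(4) by blast
  qed
qed

text \<open>With the output stuck, a covered \<open>\<sigma>\<close> would permit writing once
  \<open>\<alpha> \<restriction> Suc k\<close> is reached. So every later round reads a bit, which
  violates the length bound of \<open>trace_correct\<close>.\<close>

lemma trace_progress:
  assumes "trace K \<beta> i = (\<sigma>, x)"
  shows "\<exists>j>i. length (snd (trace K \<beta> j)) = Suc (length x)"
proof (rule ccontr)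
  assume no: "\<not> ?thesis"
  define k where "k = length x"
  have x: "snd (trace K \<beta> (i + t)) = \<alpha> \<restriction> k" for t
  proof (induction t)
    case 0
    show ?case using trace_correct[OF assms] assms by (simp add: k_def)
  next
    case (Suc t)
    obtain \<sigma>' where tr: "trace K \<beta> (i + t) = (\<sigma>', \<alpha> \<restriction> k)" using Suc by (cases "trace K \<beta> (i + t)") auto
    have "length (snd (trace K \<beta> (Suc (i + t)))) \<noteq> Suc k" using no unfolding k_def by (meson le_add1 le_imp_less_Suc)
    then show ?case
      using trace_step[OF tr _ refl] trace_correct[OF tr] by (auto split: if_splits)
  qed
  obtain s c w where s: "(c, w) \<in> stage K s" "begins \<beta> c" "prefix (\<alpha> \<restriction> Suc k) w"
    using reach[of "Suc k"] unfolding reaches_def by blast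
  have grow: "length (fst (trace K \<beta> (i + s + t))) \<ge> t" for t
  proof (induction t)
    case (Suc t)
    obtain \<sigma>' where tr: "trace K \<beta> (i + s + t) = (\<sigma>', \<alpha> \<restriction> k)"
      using x[of "s + t"] by (cases "trace K \<beta> (i + s + t)") (auto simp: add.assoc)
    have b: "begins \<beta> \<sigma>'" using trace_correct[OF tr] by blast
    have "length (snd (trace K \<beta> (Suc (i + s + t)))) = k" using x[of "Suc (s + t)"] by (simp add: add.assoc)
    then have nw: "\<not> writable K (i + s + t) \<sigma>' (\<alpha> \<restriction> Suc k)"
      using trace_step[OF tr b refl] by auto
    then have "\<not> covered K (i + s + t) \<sigma>'"
      using covered_writable[OF b _ s(1,2,3)] by auto
    then have "fst (trace K \<beta> (Suc (i + s + t))) = \<sigma>' @ [\<beta> (length \<sigma>')]"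
      using trace_step[OF tr b refl] nw by auto
    then show ?case using Suc tr by simp
  qed simp
  let ?t = "Suc (K (\<alpha> \<restriction> Suc k))"
  obtain \<sigma>' where tr: "trace K \<beta> (i + s + ?t) = (\<sigma>', \<alpha> \<restriction> k)"
    using x[of "s + ?t"] by (cases "trace K \<beta> (i + s + ?t)") (auto simp: add.assoc)
  have "length \<sigma>' \<le> K (\<alpha> \<restriction> Suc k)" using trace_correct[OF tr] by simp
  then show False using grow[of ?t] tr by simp
qed

lemma trace_unbounded: "\<exists>i. length (snd (trace K \<beta> i)) = n"
proof (induction n)
  case 0
  show ?case by (rule exI[of _ 0]) simp
next
  case (Suc n)
  then obtain i where "length (snd (trace K \<beta> i)) = n" by blast
  then show ?case using trace_progress[of i "fst (trace K \<beta> i)" "snd (trace K \<beta> i)"] by auto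
qed

end

end

section \<open>Computability of the allocation\<close>

definition piece_index :: "piece \<Rightarrow> nat" where
  "piece_index = (\<lambda>(c, w). prod_encode (enc c, enc w))"

text \<open>The binary digits of the code mark the members, so that membership becomes the parity of
  a quotient.\<close>

definition pieces_code :: "piece set \<Rightarrow> nat" where
  "pieces_code S = set_encode (piece_index ` S)"

definition mem_code :: "nat \<Rightarrow> nat \<Rightarrow> nat \<Rightarrow> bool" where
  "mem_code e c w \<longleftrightarrow> odd (e div 2 ^ prod_encode (c, w))"

lemma inj_piece_index: "inj piece_index"
  by (auto simp: inj_def piece_index_def)

lemma mem_code_iff:
  assumes "finite S"
  shows "mem_code (pieces_code S) c w \<longleftrightarrow> (dec c, dec w) \<in> S"
proof -
  have "mem_code (pieces_code S) c w \<longleftrightarrow> prod_encode (c, w) \<in> set_decode (pieces_code S)"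
    by (simp add: mem_code_def set_decode_def)
  also have "\<dots> \<longleftrightarrow> piece_index (dec c, dec w) \<in> piece_index ` S"
    using assms by (simp add: pieces_code_def piece_index_def)
  also have "\<dots> \<longleftrightarrow> (dec c, dec w) \<in> S"
    by (rule inj_image_mem_iff[OF inj_piece_index])
  finally show ?thesis .
qed

text \<open>Bounding the members by the code itself turns quantifiers over a stage into bounded
  ones.\<close>

lemma mem_code_less:
  assumes "mem_code e c w"
  shows "c < e \<and> w < e"
proof -
  have "e div 2 ^ prod_encode (c, w) \<noteq> 0"
    using assms unfolding mem_code_def by (metis even_zero)
  then have "2 ^ prod_encode (c, w) \<le> e" by (metis div_less not_le)
  moreover have "prod_encode (c, w) < 2 ^ prod_encode (c, w)" by (rule less_exp)
  ultimately have "prod_encode (c, w) < e" by linarith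
  then show ?thesis using le_prod_encode_1[of c w] le_prod_encode_2[of w c] by linarith
qed

lemma pieces_code_ball:
  assumes "finite S"
  shows "(\<forall>(c, w)\<in>S. P c w) \<longleftrightarrow>
    (\<forall>c<pieces_code S. \<forall>w<pieces_code S. mem_code (pieces_code S) c w \<longrightarrow> P (dec c) (dec w))"
proof
  assume "\<forall>(c, w)\<in>S. P c w"
  then show "\<forall>c<pieces_code S. \<forall>w<pieces_code S. mem_code (pieces_code S) c w \<longrightarrow> P (dec c) (dec w)"
    using mem_code_iff[OF assms] by blast
next
  assume r: "\<forall>c<pieces_code S. \<forall>w<pieces_code S. mem_code (pieces_code S) c w \<longrightarrow> P (dec c) (dec w)"
  have "P c w" if "(c, w) \<in> S" for c w
  proof -
    have m: "mem_code (pieces_code S) (enc c) (enc w)" using that mem_code_iff[OF assms] by simp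
    then have "P (dec (enc c)) (dec (enc w))" using r mem_code_less[OF m] by blast
    then show ?thesis by simp
  qed
  then show "\<forall>(c, w)\<in>S. P c w" by blast
qed

lemma pieces_code_bex:
  assumes "finite S"
  shows "(\<exists>(c, w)\<in>S. P c w) \<longleftrightarrow>
    (\<exists>c<pieces_code S. \<exists>w<pieces_code S. mem_code (pieces_code S) c w \<and> P (dec c) (dec w))"
  using pieces_code_ball[OF assms, of "\<lambda>c w. \<not> P c w"] by blast

text \<open>Rebuilds the code from the membership predicate and a bound on the members; this is how
  the next stage is computed.\<close>

lemma pieces_code_eq_sum:
  assumes "finite S" "\<And>c w. (c, w) \<in> S \<Longrightarrow> enc c < B \<and> enc w < B"
  shows "pieces_code S =
    (\<Sum>c<B. \<Sum>w<B. of_bool ((dec c, dec w) \<in> S) * 2 ^ prod_encode (c, w))"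
proof -
  define f where "f = (\<lambda>(c, w). (dec c, dec w))"
  define A where "A = {p \<in> {..<B} \<times> {..<B}. f p \<in> S}"
  have inj: "inj_on f A" by (auto simp: inj_on_def f_def)
  have S: "S = f ` A"
  proof (rule set_eqI, rule iffI)
    fix p assume "p \<in> S"
    then have "p = f (enc (fst p), enc (snd p))" "(enc (fst p), enc (snd p)) \<in> A"
      using assms(2)[of "fst p" "snd p"] by (auto simp: A_def f_def)
    then show "p \<in> f ` A" by blast
  qed (auto simp: A_def)
  have "pieces_code S = (\<Sum>p\<in>S. 2 ^ piece_index p)"
    unfolding pieces_code_def set_encode_def
    using sum.reindex[OF inj_on_subset[OF inj_piece_index subset_UNIV], of "(^) 2" S] by simp
  also have "\<dots> = (\<Sum>p\<in>A. 2 ^ piece_index (f p))"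
    unfolding S by (simp add: sum.reindex[OF inj])
  also have "\<dots> = (\<Sum>p\<in>{..<B} \<times> {..<B}. if f p \<in> S then 2 ^ piece_index (f p) else 0)"
    unfolding A_def by (rule sum.inter_filter) simp
  also have "\<dots> = (\<Sum>p\<in>{..<B} \<times> {..<B}. of_bool (f p \<in> S) * 2 ^ prod_encode p)"
    by (rule sum.cong) (auto simp: f_def piece_index_def)
  also have "\<dots> = (\<Sum>c<B. \<Sum>w<B. of_bool ((dec c, dec w) \<in> S) * 2 ^ prod_encode (c, w))"
    unfolding sum.cartesian_product by (rule sum.cong) (auto simp: f_def)
  finally show ?thesis .
qed

lemma enc_le_enc: "prefix u v \<Longrightarrow> enc u \<le> enc v"
  by (cases "u = v") (use enc_less_enc[of u v] in \<open>auto simp: strict_prefix_def\<close>)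

text \<open>A prefix never has a larger code, so the search through strings is bounded.\<close>

lemma all_prefix_dec: "(\<forall>u. P u \<longrightarrow> prefix u (dec x) \<longrightarrow> Q u) \<longleftrightarrow>
    (\<forall>u<Suc x. P (dec u) \<longrightarrow> prefix (dec u) (dec x) \<longrightarrow> Q (dec u))"
proof
  assume r: "\<forall>u<Suc x. P (dec u) \<longrightarrow> prefix (dec u) (dec x) \<longrightarrow> Q (dec u)"
  show "\<forall>u. P u \<longrightarrow> prefix u (dec x) \<longrightarrow> Q u"
  proof (intro allI impI)
    fix u assume u: "P u" "prefix u (dec x)"
    have "enc u < Suc x" using enc_le_enc[OF u(2)] by simp
    then show "Q u" using r u by (metis dec_enc)
  qed
qed blast

definition selected_code :: "(bool list \<Rightarrow> nat) \<Rightarrow> nat \<Rightarrow> nat \<Rightarrow> nat \<Rightarrow> nat \<Rightarrow> bool" where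
  "selected_code K x e c w \<longleftrightarrow> mem_code e c w \<and> usable K (dec x) (dec c, dec w) \<and>
    (\<forall>d<e. \<forall>v<e. mem_code e d v \<longrightarrow> usable K (dec x) (dec d, dec v) \<longrightarrow>
      length (dec v) < length (dec w) \<or> v = w \<and> length (dec d) \<le> length (dec c))"

definition refine_mem_code :: "(bool list \<Rightarrow> nat) \<Rightarrow> nat \<Rightarrow> nat \<Rightarrow> nat \<Rightarrow> nat \<Rightarrow> bool" where
  "refine_mem_code K x e d v \<longleftrightarrow> mem_code e d v \<and> \<not> selected_code K x e d v \<or>
    (\<exists>c<e. \<exists>w<e. selected_code K x e c w \<and> (dec d, dec v) \<in> trim K (dec x) (dec c, dec w))"

text \<open>The summands of \<open>B\<close> bound, in this order, the codes in old pieces, the new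
  cylinders, whose length is at most \<open>K (dec x)\<close>, and the new labels, which are
  prefixes of \<open>dec x\<close>.\<close>

definition refine_code :: "(bool list \<Rightarrow> nat) \<Rightarrow> nat \<Rightarrow> nat \<Rightarrow> nat" where
  "refine_code K x e = (let B = e + 2 ^ Suc (K (dec x)) + Suc x in
    \<Sum>d<B. \<Sum>v<B. of_bool (refine_mem_code K x e d v) * 2 ^ prod_encode (d, v))"

lemma selected_code_iff:
  assumes "finite S"
  shows "selected_code K x (pieces_code S) c w \<longleftrightarrow> selected K (dec x) S (dec c, dec w)"
proof -
  have "(\<forall>q\<in>S. usable K (dec x) q \<longrightarrow> length (snd q) < length (dec w) \<or>
      snd q = dec w \<and> length (fst q) \<le> length (dec c)) \<longleftrightarrow>
    (\<forall>(d, v)\<in>S. usable K (dec x) (d, v) \<longrightarrow> length v < length (dec w) \<or>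
      v = dec w \<and> length d \<le> length (dec c))"
    by auto
  then show ?thesis
    unfolding selected_code_def selected_def
    by (simp add: mem_code_iff[OF assms] pieces_code_ball[OF assms])
qed

lemma refine_mem_code_iff:
  assumes "finite S"
  shows "refine_mem_code K x (pieces_code S) d v \<longleftrightarrow> (dec d, dec v) \<in> refine K (dec x) S"
proof -
  have "(\<exists>p\<in>S. selected K (dec x) S p \<and> (dec d, dec v) \<in> trim K (dec x) p) \<longleftrightarrow>
    (\<exists>(c, w)\<in>S. selected K (dec x) S (c, w) \<and> (dec d, dec v) \<in> trim K (dec x) (c, w))"
    by auto
  also have "\<dots> \<longleftrightarrow> (\<exists>c<pieces_code S. \<exists>w<pieces_code S. mem_code (pieces_code S) c w \<and>
      selected K (dec x) S (dec c, dec w) \<and> (dec d, dec v) \<in> trim K (dec x) (dec c, dec w))"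
    by (rule pieces_code_bex[OF assms])
  also have "\<dots> \<longleftrightarrow> (\<exists>c<pieces_code S. \<exists>w<pieces_code S.
      selected K (dec x) S (dec c, dec w) \<and> (dec d, dec v) \<in> trim K (dec x) (dec c, dec w))"
    unfolding mem_code_iff[OF assms] selected_def by blast
  finally have "(\<exists>p\<in>S. selected K (dec x) S p \<and> (dec d, dec v) \<in> trim K (dec x) p) \<longleftrightarrow>
    (\<exists>c<pieces_code S. \<exists>w<pieces_code S.
      selected K (dec x) S (dec c, dec w) \<and> (dec d, dec v) \<in> trim K (dec x) (dec c, dec w))" .
  moreover have "(dec d, dec v) \<in> refine K (dec x) S \<longleftrightarrow>
    (dec d, dec v) \<in> S \<and> \<not> selected K (dec x) S (dec d, dec v) \<or>
    (\<exists>p\<in>S. selected K (dec x) S p \<and> (dec d, dec v) \<in> trim K (dec x) p)"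
    by (auto simp: refine_def)
  ultimately show ?thesis
    unfolding refine_mem_code_def mem_code_iff[OF assms] selected_code_iff[OF assms] by blast
qed

lemma refine_code_eq:
  assumes "allocation K W S" "finite (refine K (dec x) S)"
  shows "refine_code K x (pieces_code S) = pieces_code (refine K (dec x) S)"
proof -
  note fin = allocation_finite[OF assms(1)]
  let ?B = "pieces_code S + 2 ^ Suc (K (dec x)) + Suc x"
  have "enc c < ?B \<and> enc w < ?B" if mem: "(c, w) \<in> refine K (dec x) S" for c w
  proof (cases "(c, w) \<in> S")
    case True
    then have "mem_code (pieces_code S) (enc c) (enc w)" using mem_code_iff[OF fin] by simp
    then show ?thesis using mem_code_less by fastforce
  next
    case False
    then have "\<exists>p. selected K (dec x) S p \<and> (c, w) \<in> trim K (dec x) p"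
      using mem by (auto simp: refine_def)
    then obtain c0 w0 where "selected K (dec x) S (c0, w0)" and trim: "(c, w) \<in> trim K (dec x) (c0, w0)"
      by auto
    then have p: "usable K (dec x) (c0, w0)" "(c, w) \<in> trim K (dec x) (c0, w0)"
      by (simp_all add: selected_def)
    have "length c0 \<le> K (dec x)" using p(1) by (simp add: usable_def)
    then have "length c \<le> K (dec x)" using p(2) unfolding trim_iff by auto
    then have "(2::nat) ^ Suc (length c) \<le> 2 ^ Suc (K (dec x))" by (intro power_increasing) simp_all
    moreover have "Suc (enc c) < 2 ^ Suc (length c)" using length_dec_bounds[of "enc c"] by simp
    ultimately have "enc c < 2 ^ Suc (K (dec x))" by linarith
    moreover have "enc w \<le> x" using enc_le_enc[of w "dec x"] trim_labels[OF p(2,1)] by simp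
    ultimately show ?thesis by linarith
  qed
  then show ?thesis
    unfolding refine_code_def Let_def refine_mem_code_iff[OF fin]
    by (intro pieces_code_eq_sum[symmetric] assms(2))
qed

definition stage_code :: "(bool list \<Rightarrow> nat) \<Rightarrow> nat \<Rightarrow> nat" where
  "stage_code K = rec_nat (pieces_code {([], [])}) (\<lambda>m e. refine_code K (Suc m) e)"

lemma (in kraft) stage_finite: "finite (stage K m)"
  by (rule allocation_finite[OF stage_allocation])

lemma (in kraft) stage_code_eq: "stage_code K m = pieces_code (stage K m)"
proof (induction m)
  case (Suc m)
  then show ?case
    using refine_code_eq[OF stage_allocation, of "Suc m" m] stage_finite[of "Suc m"]
    by (simp add: stage_code_def)
qed (simp add: stage_code_def)

definition covered_code :: "(bool list \<Rightarrow> nat) \<Rightarrow> nat \<Rightarrow> nat \<Rightarrow> bool" where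
  "covered_code K m \<sigma> \<longleftrightarrow> (\<exists>c<stage_code K m. \<exists>w<stage_code K m.
    mem_code (stage_code K m) c w \<and> prefix (dec c) (dec \<sigma>))"

definition writable_code :: "(bool list \<Rightarrow> nat) \<Rightarrow> nat \<Rightarrow> nat \<Rightarrow> nat \<Rightarrow> bool" where
  "writable_code K m \<sigma> y \<longleftrightarrow> (\<forall>c<stage_code K m. \<forall>w<stage_code K m.
    mem_code (stage_code K m) c w \<longrightarrow> prefix (dec c) (dec \<sigma>) \<or> prefix (dec \<sigma>) (dec c) \<longrightarrow>
    prefix (dec y) (dec w))"

lemma (in kraft) covered_code_iff: "covered_code K m \<sigma> \<longleftrightarrow> covered K m (dec \<sigma>)"
  unfolding covered_code_def covered_def stage_code_eq
  using pieces_code_bex[OF stage_finite, where P = "\<lambda>c w. prefix c (dec \<sigma>)"] by simp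

lemma (in kraft) writable_code_iff: "writable_code K m \<sigma> y \<longleftrightarrow> writable K m (dec \<sigma>) (dec y)"
  unfolding writable_code_def writable_def stage_code_eq
  using pieces_code_ball[OF stage_finite,
      where P = "\<lambda>c w. prefix c (dec \<sigma>) \<or> prefix (dec \<sigma>) c \<longrightarrow> prefix (dec y) w"] by simp

lemma decidable_mem_code [computable_intros]:
  assumes "computable e" "computable c" "computable w"
  shows "decidable (\<lambda>s. mem_code (e s) (c s) (w s))"
  unfolding mem_code_def by (intro computable_intros assms)

lemma decidable_strict_prefix [computable_intros]:
  assumes "computable a" "computable b"
  shows "decidable (\<lambda>s. strict_prefix (dec (a s)) (dec (b s)))"
  unfolding strict_prefix_def dec_eq_iff by (intro computable_intros assms)

context
  fixes K :: "bool list \<Rightarrow> nat"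
  assumes K: "total_computable K"
begin

lemmas computable_K = computable_fun_dec[OF K]

lemma decidable_usable:
  assumes "computable x" "computable c" "computable w"
  shows "decidable (\<lambda>s. usable K (dec (x s)) (dec (c s), dec (w s)))"
  unfolding usable_def prod.case all_prefix_dec
  by (intro computable_intros computable_K assms assms[THEN computable_rename])

lemma decidable_selected_code:
  assumes "computable x" "computable e" "computable c" "computable w"
  shows "decidable (\<lambda>s. selected_code K (x s) (e s) (c s) (w s))"
  unfolding selected_code_def
  by (intro computable_intros decidable_usable assms assms[THEN computable_rename])

lemma decidable_offcut_label:
  assumes "computable x" "computable w" "computable l" "computable v"
  shows "decidable (\<lambda>s. offcut_label K (dec (x s)) (dec (w s)) (l s) (dec (v s)))"
  unfolding offcut_label_def all_prefix_dec dec_eq_iff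
  by (intro computable_intros computable_K assms assms[THEN computable_rename])

end

lemma Suc_enc_replicate: "Suc (enc (c @ replicate j False)) = Suc (enc c) * 2 ^ j"
proof (induction j)
  case (Suc j)
  have "c @ replicate (Suc j) False = (c @ replicate j False) @ [False]"
    by (simp flip: replicate_append_same)
  then show ?case using Suc enc_snoc[of "c @ replicate j False" False] by simp
qed simp

lemma dec_eq_iff_enc: "dec d = x \<longleftrightarrow> d = enc x"
  by (metis dec_enc enc_dec)

text \<open>Appending a zero doubles the successor of the code, so \<open>j\<close> zeros multiply
  it by \<open>2 ^ j\<close>; a final one makes the code itself twice that product.\<close>

lemma trim_dec_iff: "(dec d, dec v) \<in> trim K x (dec c, w) \<longleftrightarrow>
    (\<exists>j<K x. d = 2 * (Suc c * 2 ^ j) \<and> j < K x - length (dec c) \<and>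
      offcut_label K x w (length (dec c) + j) (dec v)) \<or>
    Suc d = Suc c * 2 ^ (K x - length (dec c)) \<and> dec v = x"
proof -
  have "dec d = dec c @ replicate j False \<longleftrightarrow> Suc d = Suc c * 2 ^ j" for j
    unfolding dec_eq_iff_enc using Suc_enc_replicate[of "dec c" j] by auto
  moreover have "dec d = dec c @ replicate j False @ [True] \<longleftrightarrow> d = 2 * (Suc c * 2 ^ j)" for j
    unfolding dec_eq_iff_enc
    using Suc_enc_replicate[of "dec c" j] enc_snoc[of "dec c @ replicate j False" True] by auto
  ultimately show ?thesis by (simp only: trim_iff) (auto intro: less_le_trans[OF _ diff_le_self])
qed

context
  fixes K :: "bool list \<Rightarrow> nat"
  assumes K: "total_computable K"
begin

lemma decidable_trim:
  assumes "computable x" "computable c" "computable w" "computable d" "computable v"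
  shows "decidable (\<lambda>s. (dec (d s), dec (v s)) \<in> trim K (dec (x s)) (dec (c s), dec (w s)))"
  unfolding trim_dec_iff dec_eq_iff
  by (intro computable_intros computable_K[OF K] decidable_offcut_label[OF K] assms
      assms[THEN computable_rename])

lemma decidable_refine_mem_code:
  assumes "computable x" "computable e" "computable d" "computable v"
  shows "decidable (\<lambda>s. refine_mem_code K (x s) (e s) (d s) (v s))"
  unfolding refine_mem_code_def
  by (intro computable_intros decidable_selected_code[OF K] decidable_trim assms
      assms[THEN computable_rename])

lemma computable_refine_code:
  assumes "computable x" "computable e"
  shows "computable (\<lambda>s. refine_code K (x s) (e s))"
  unfolding refine_code_def Let_def
  by (intro computable_intros computable_K[OF K] decidable_refine_mem_code assms
      assms[THEN computable_rename])

lemma computable_stage_code: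
  assumes "computable m"
  shows "computable (\<lambda>s. stage_code K (m s))"
  unfolding stage_code_def
  by (intro computable_rec[of "\<lambda>m e s. refine_code K (Suc m) e"] computable_refine_code
      computable_intros assms)

lemma decidable_covered_code:
  assumes "computable m" "computable \<sigma>"
  shows "decidable (\<lambda>s. covered_code K (m s) (\<sigma> s))"
  unfolding covered_code_def
  by (intro computable_intros computable_stage_code assms assms[THEN computable_rename])

lemma decidable_writable_code:
  assumes "computable m" "computable \<sigma>" "computable y"
  shows "decidable (\<lambda>s. writable_code K (m s) (\<sigma> s) (y s))"
  unfolding writable_code_def
  by (intro computable_intros computable_stage_code assms assms[THEN computable_rename])

end

section \<open>The oracle machine\<close>

lemma leads_Cons: "io c \<in> X \<Longrightarrow> leads \<beta> X (step \<beta> c) c' \<Longrightarrow> leads \<beta> X c c'"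
proof -
  assume c: "io c \<in> X" and l: "leads \<beta> X (step \<beta> c) c'"
  have "io (step \<beta> c) \<in> X" using l unfolding leads_def by force
  from leads_trans[OF leads_step[OF c this] l] show ?thesis .
qed

lemma leads_pure:
  assumes "pure_run p s s'" "(b, w) \<in> X" "leads \<beta> X (conf q s' b w) c"
  shows "leads \<beta> X (conf (p @ q) s b w) c"
proof -
  have "leads \<beta> {(b, w)} (conf (p @ q) s b w) (conf q s' b w)"
    using assms(1) by (simp add: pure_run_def)
  then have "leads \<beta> X (conf (p @ q) s b w) (conf q s' b w)"
    by (rule leads_mono) (simp add: assms(2))
  then show ?thesis using assms(3) by (rule leads_trans)
qed

lemma leads_exit:
  "s r = 0 \<Longrightarrow> (b, w) \<in> X \<Longrightarrow> leads \<beta> X (conf q s b w) c \<Longrightarrow> leads \<beta> X (conf (While r p # q) s b w) c"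
  using leads_pure[OF pure_run_While_exit[of s r p]] by simp

lemma leads_enter:
  "s r \<noteq> 0 \<Longrightarrow> (b, w) \<in> X \<Longrightarrow> leads \<beta> X (conf (p @ While r p # q) s b w) c \<Longrightarrow>
    leads \<beta> X (conf (While r p # q) s b w) c"
  by (rule leads_Cons) (simp_all add: io_def step_def)

lemma leads_Write:
  "(b, w) \<in> X \<Longrightarrow> leads \<beta> X (conf q s b (w @ [s r \<noteq> 0])) c \<Longrightarrow>
    leads \<beta> X (conf (Write r # q) s b w) c"
  by (rule leads_Cons) (simp_all add: io_def step_def)

lemma leads_Read:
  "(b, w) \<in> X \<Longrightarrow> leads \<beta> X (conf q (s(r := of_bool (\<beta> b))) (b + 1) w) c \<Longrightarrow>
    leads \<beta> X (conf (Read r # q) s b w) c"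
  by (rule leads_Cons) (simp_all add: io_def step_def)

text \<open>The value is first pushed onto the stack, since \<open>e\<close> may depend on the old
  content of \<open>r\<close>.\<close>

lemma assign_ex:
  assumes "computable e" "r < d"
  shows "\<exists>p. \<forall>s. (\<forall>r\<ge>d. s r = 0) \<longrightarrow> pure_run p s (s(r := e s))"
proof -
  obtain p where p: "\<And>s. (\<And>r. r \<ge> d \<Longrightarrow> s r = 0) \<Longrightarrow> pure_run p s (s(d := e (\<lambda>i. s i)))"
    using computableE[OF assms(1), of d "\<lambda>i. i"] by blast
  have "pure_run (p @ [clear r, move d r]) s (s(r := e s))" if z: "\<forall>r\<ge>d. s r = 0" for s
  proof -
    let ?s2 = "s(d := e s, r := 0)"
    have 1: "pure_run p s (s(d := e s))" using p z by simp
    have 2: "pure_run [clear r] (s(d := e s)) ?s2" by (rule pure_run_clear)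
    have "?s2(r := ?s2 r + ?s2 d, d := 0) = s(r := e s)"
      using z assms(2) by (intro ext) auto
    with pure_run_move[of d r ?s2] assms(2) have 3: "pure_run [move d r] ?s2 (s(r := e s))"
      by simp
    show ?thesis by (rule pure_run_append[OF 1 pure_run_Cons[OF 2 3]])
  qed
  then show ?thesis by blast
qed

text \<open>Registers 0, 1, 2 hold the oracle bits read, the output and the number of the round,
  register 3 is the constant one; registers 4 to 6 are flags.\<close>

lemma machine_ex:
  assumes "kraft K" and K: "total_computable K"
  shows "\<exists>M. \<forall>\<beta>. \<exists>H. H 0 = run M \<beta> 1 \<and> io (run M \<beta> 0) = io (H 0) \<and>
    (\<forall>m. io (H m) = (length (fst (trace K \<beta> m)), snd (trace K \<beta> m)) \<and>
      H m \<noteq> H (Suc m) \<and> leads \<beta> {io (H m), io (H (Suc m))} (H m) (H (Suc m)))"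
proof -
  interpret kraft K by fact
  \<comment> \<open>By \<open>enc_snoc\<close> the last argument is the code of the output extended
    by \<open>b\<close>.\<close>
  define wr where "wr b s = writable_code K (s 2) (s 0) (2 * s 1 + 1 + of_bool b)"
    for b and s :: "nat \<Rightarrow> nat"
  have dec_wr: "decidable (wr b)" for b
    unfolding wr_def by (intro decidable_writable_code[OF K] computable_intros)
  have wr_iff: "wr b s \<longleftrightarrow> writable K (s 2) (dec (s 0)) (dec (s 1) @ [b])" for b s
    unfolding wr_def writable_code_iff dec_snoc ..
  define wflag where "wflag s = (of_bool (wr False s \<or> wr True s) :: nat)" for s
  \<comment> \<open>Zero is tried first, as in \<open>trace\<close>; the value matters only when
    \<open>wflag\<close> is set.\<close>
  define wbit where "wbit s = (of_bool (\<not> wr False s) :: nat)" for s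
  define rflag where "rflag s = (of_bool (\<not> (wr False s \<or> wr True s) \<and> \<not> covered_code K (s 2) (s 0)) :: nat)" for s
  have "computable wflag"
    unfolding wflag_def by (intro computable_intros dec_wr)
  then obtain p4 where p4: "\<And>s. \<forall>r\<ge>7. s r = 0 \<Longrightarrow> pure_run p4 s (s(4 := wflag s))"
    using assign_ex[of wflag 4 7] by auto
  have "computable wbit"
    unfolding wbit_def by (intro computable_intros dec_wr)
  then obtain p5 where p5: "\<And>s. \<forall>r\<ge>7. s r = 0 \<Longrightarrow> pure_run p5 s (s(5 := wbit s))"
    using assign_ex[of wbit 5 7] by auto
  have "computable rflag"
    unfolding rflag_def by (intro computable_intros dec_wr decidable_covered_code[OF K])
  then obtain p6 where p6: "\<And>s. \<forall>r\<ge>7. s r = 0 \<Longrightarrow> pure_run p6 s (s(6 := rflag s))"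
    using assign_ex[of rflag 6 7] by auto
  have "computable (\<lambda>s. 2 * s 1 + 1 + s 5)" by (intro computable_intros)
  then obtain p1 where p1: "\<And>s. \<forall>r\<ge>7. s r = 0 \<Longrightarrow> pure_run p1 s (s(1 := 2 * s 1 + 1 + s 5))"
    using assign_ex[of "\<lambda>s. 2 * s 1 + 1 + s 5" 1 7] by auto
  have "computable (\<lambda>s. 2 * s 0 + 1 + s 6)" by (intro computable_intros)
  then obtain p0 where p0: "\<And>s. \<forall>r\<ge>7. s r = 0 \<Longrightarrow> pure_run p0 s (s(0 := 2 * s 0 + 1 + s 6))"
    using assign_ex[of "\<lambda>s. 2 * s 0 + 1 + s 6" 0 7] by auto
  \<comment> \<open>Both loops act as conditionals, since each body zeroes its flag. Register 6 is
    first the flag for reading, then receives the oracle bit, and is cleared once the bit is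
    appended.\<close>
  define wloop where "wloop = Write 5 # p1 @ [Dec 4]"
  define rloop where "rloop = Read 6 # p0 @ [clear 6]"
  define body where "body = p4 @ p5 @ p6 @ [While 4 wloop, While 6 rloop, clear 5, Inc 2]"
  define M where "M = [Inc 3, While 3 body]"
  define R where "R a x m = (\<lambda>_ :: nat. 0 :: nat)(0 := a, 1 := x, 2 := m, 3 := 1)" for a x m
  define R' where "R' a x m f b g = (R a x m)(4 := f, 5 := b, 6 := g)" for a x m f b g
  have R'_simps: "R' a x m f b g 0 = a" "R' a x m f b g (Suc 0) = x" "R' a x m f b g 1 = x" "R' a x m f b g 2 = m"
    "R' a x m f b g 4 = f" "R' a x m f b g 5 = b" "R' a x m f b g 6 = g"
    "\<forall>r\<ge>7. R' a x m f b g r = 0" for a x m f b g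
    by (simp_all add: R'_def R_def)
  have R'_upd: "(R' a x m f b g)(0 := k) = R' k x m f b g" "(R' a x m f b g)(1 := k) = R' a k m f b g"
    "(R' a x m f b g)(Suc 0 := k) = R' a k m f b g"
    "(R' a x m f b g)(2 := k) = R' a x k f b g" "(R' a x m f b g)(4 := k) = R' a x m k b g"
    "(R' a x m f b g)(5 := k) = R' a x m f k g" "(R' a x m f b g)(6 := k) = R' a x m f b k" for a x m f b g k
    by (auto simp: R'_def R_def fun_eq_iff)
  have R_eq: "R a x m = R' a x m 0 0 0" for a x m
    by (auto simp: R'_def R_def fun_eq_iff)
  \<comment> \<open>The configuration at the head of the main loop when round \<open>m\<close>
    begins.\<close>
  define H where "H \<beta> m = (case trace K \<beta> m of (\<sigma>, x) \<Rightarrow>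
    conf [While 3 body] (R (enc \<sigma>) (enc x) m) (length \<sigma>) x)" for \<beta> m
  have round: "leads \<beta> {io (H \<beta> m), io (H \<beta> (Suc m))} (H \<beta> m) (H \<beta> (Suc m))" for \<beta> m
  proof -
    obtain \<sigma> x where tr: "trace K \<beta> m = (\<sigma>, x)" by fastforce
    obtain \<sigma>' x' where tr': "trace K \<beta> (Suc m) = (\<sigma>', x')" by fastforce
    define X where "X = {(length \<sigma>, x), (length \<sigma>', x')}"
    have X: "{io (H \<beta> m), io (H \<beta> (Suc m))} = X"
      unfolding H_def tr tr' X_def by (simp add: io_def)
    have in_X: "(length \<sigma>, x) \<in> X" "(length \<sigma>', x') \<in> X" by (simp_all add: X_def)
    let ?W = "[While 3 body]"
    define s where "s = R' (enc \<sigma>) (enc x) m"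
    let ?s = "s 0 0 0"
    have "wr b (s f c g) \<longleftrightarrow> writable K m \<sigma> (x @ [b])" for b f c g
      by (simp add: wr_iff s_def R'_simps)
    moreover have "covered_code K (s f c g 2) (s f c g 0) \<longleftrightarrow> covered K m \<sigma>" for f c g
      by (simp add: covered_code_iff s_def R'_simps)
    ultimately have flags:
      "wflag (s f c g) = of_bool (writable K m \<sigma> (x @ [False]) \<or> writable K m \<sigma> (x @ [True]))"
      "wbit (s f c g) = of_bool (\<not> writable K m \<sigma> (x @ [False]))"
      "rflag (s f c g) = of_bool (\<not> (writable K m \<sigma> (x @ [False]) \<or> writable K m \<sigma> (x @ [True])) \<and>
        \<not> covered K m \<sigma>)" for f c g
      unfolding wflag_def wbit_def rflag_def by simp_all
    define F where "F = wflag ?s"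
    define B where "B = wbit ?s"
    define G where "G = rflag ?s"
    have z: "\<forall>r\<ge>7. s f c g r = 0" for f c g by (simp add: s_def R'_simps)
    have upd: "(s f c g)(4 := k) = s k c g" "(s f c g)(5 := k) = s f k g" "(s f c g)(6 := k) = s f c k" for f c g k
      by (simp_all only: s_def R'_upd)
    have a4: "pure_run p4 ?s (s F 0 0)" using p4[OF z[of 0 0 0]] by (simp only: upd F_def)
    have a5: "pure_run p5 (s F 0 0) (s F B 0)"
      using p5[OF z[of F 0 0]] by (simp only: upd B_def flags)
    have a6: "pure_run p6 (s F B 0) (s F B G)"
      using p6[OF z[of F B 0]] by (simp only: upd G_def flags)
    have finish: "leads \<beta> X (conf (clear 5 # Inc 2 # ?W) (R' a y m 0 c 0) n v)
        (conf ?W (R a y (Suc m)) n v)" if nv: "(n, v) \<in> X" for a y c n v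
    proof -
      have "pure_run [clear 5, Inc 2] (R' a y m 0 c 0) (R a y (Suc m))"
        using pure_run_Cons[OF pure_run_clear[of 5] pure_run_Inc[of 2], of "R' a y m 0 c 0"]
        by (simp add: R'_simps R'_upd R_eq del: fun_upd_apply)
      from leads_pure[OF this nv leads_refl] show ?thesis by (simp add: io_def nv)
    qed
    have rest: "leads \<beta> X (conf (While 4 wloop # While 6 rloop # clear 5 # Inc 2 # ?W) (s F B G)
        (length \<sigma>) x) (H \<beta> (Suc m))"
    proof -
      consider (emit) b where "F = 1" "G = 0" "B = of_bool b" "\<sigma>' = \<sigma>" "x' = x @ [b]"
        | (idle) "F = 0" "G = 0" "\<sigma>' = \<sigma>" "x' = x"
        | (fetch) "F = 0" "G = 1" "\<sigma>' = \<sigma> @ [\<beta> (length \<sigma>)]" "x' = x"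
        using tr' tr unfolding F_def B_def G_def flags by (auto split: if_splits)
      then show ?thesis
      proof cases
        case emit
        have p: "pure_run (p1 @ [Dec 4]) (s 1 B G) (R' (enc \<sigma>) (enc x') m 0 B 0)"
        proof -
          have "pure_run p1 (s 1 B G) (R' (enc \<sigma>) (enc x') m 1 B 0)"
            using p1[OF z[of 1 B G]] emit by (simp add: s_def R'_simps R'_upd enc_snoc del: fun_upd_apply)
          moreover have "pure_run [Dec 4] (R' (enc \<sigma>) (enc x') m 1 B 0) (R' (enc \<sigma>) (enc x') m 0 B 0)"
            using pure_run_Dec[of 4 "R' (enc \<sigma>) (enc x') m 1 B 0"]
            by (simp add: R'_simps R'_upd del: fun_upd_apply)
          ultimately show ?thesis by (rule pure_run_append)
        qed
        have "x @ [s 1 B G 5 \<noteq> 0] = x'" using emit by (simp add: s_def R'_simps)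
        have fin: "H \<beta> (Suc m) = conf ?W (R (enc \<sigma>) (enc x') (Suc m)) (length \<sigma>) x'"
          unfolding H_def tr' using emit by simp
        have inX: "(length \<sigma>, x') \<in> X" using in_X emit by simp
        have l1: "leads \<beta> X (conf (While 4 wloop # While 6 rloop # clear 5 # Inc 2 # ?W)
            (R' (enc \<sigma>) (enc x') m 0 B 0) (length \<sigma>) x') (H \<beta> (Suc m))"
          unfolding fin
          by (rule leads_exit[OF _ inX leads_exit[OF _ inX finish[OF inX]]]) (simp_all only: R'_simps)
        have l2: "leads \<beta> X (conf (wloop @ While 4 wloop # While 6 rloop # clear 5 # Inc 2 # ?W) (s 1 B G)
            (length \<sigma>) x) (H \<beta> (Suc m))"
          using leads_Write[OF in_X(1), where r = 5 and s = "s 1 B G"] leads_pure[OF p inX l1]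
            \<open>x @ [s 1 B G 5 \<noteq> 0] = x'\<close> by (simp add: wloop_def)
        show ?thesis
          unfolding \<open>F = 1\<close>
          by (rule leads_enter[OF _ in_X(1) l2]) (simp add: s_def R'_simps)
      next
        case idle
        have fin: "H \<beta> (Suc m) = conf ?W (R (enc \<sigma>) (enc x) (Suc m)) (length \<sigma>) x"
          unfolding H_def tr' using idle by simp
        show ?thesis
          unfolding fin idle s_def
          by (rule leads_exit[OF _ in_X(1) leads_exit[OF _ in_X(1) finish[OF in_X(1)]]])
            (simp_all only: R'_simps)
      next
        case fetch
        have fin: "H \<beta> (Suc m) = conf ?W (R (enc \<sigma>') (enc x) (Suc m)) (Suc (length \<sigma>)) x"
          unfolding H_def tr' using fetch by simp
        have inX: "(Suc (length \<sigma>), x) \<in> X" using in_X(2) fetch by simp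
        let ?b = "of_bool (\<beta> (length \<sigma>)) :: nat"
        have p: "pure_run (p0 @ [clear 6]) (s 0 B ?b) (R' (enc \<sigma>') (enc x) m 0 B 0)"
        proof -
          have "pure_run p0 (s 0 B ?b) (R' (enc \<sigma>') (enc x) m 0 B ?b)"
            using p0[OF z[of 0 B ?b]] fetch by (simp add: s_def R'_simps R'_upd enc_snoc del: fun_upd_apply)
          moreover have "pure_run [clear 6] (R' (enc \<sigma>') (enc x) m 0 B ?b) (R' (enc \<sigma>') (enc x) m 0 B 0)"
            using pure_run_clear[of 6 "R' (enc \<sigma>') (enc x) m 0 B ?b"]
            by (simp only: R'_upd)
          ultimately show ?thesis by (rule pure_run_append)
        qed
        have l1: "leads \<beta> X (conf (While 6 rloop # clear 5 # Inc 2 # ?W)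
            (R' (enc \<sigma>') (enc x) m 0 B 0) (Suc (length \<sigma>)) x) (H \<beta> (Suc m))"
          unfolding fin
          by (rule leads_exit[OF _ inX finish[OF inX]]) (simp_all only: R'_simps)
        have l2: "leads \<beta> X (conf (p0 @ clear 6 # While 6 rloop # clear 5 # Inc 2 # ?W) (s 0 B ?b)
            (length \<sigma> + 1) x) (H \<beta> (Suc m))"
          using leads_pure[OF p inX l1] by simp
        have l3: "leads \<beta> X (conf (rloop @ While 6 rloop # clear 5 # Inc 2 # ?W) (s 0 B 1)
            (length \<sigma>) x) (H \<beta> (Suc m))"
          using leads_Read[OF in_X(1), where r = 6 and s = "s 0 B 1", unfolded upd, OF l2]
          by (simp add: rloop_def)
        have l4: "leads \<beta> X (conf (While 6 rloop # clear 5 # Inc 2 # ?W) (s 0 B 1)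
            (length \<sigma>) x) (H \<beta> (Suc m))"
          by (rule leads_enter[OF _ in_X(1) l3]) (simp add: s_def R'_simps)
        show ?thesis
          unfolding \<open>F = 0\<close> \<open>G = 1\<close>
          by (rule leads_exit[OF _ in_X(1) l4]) (simp add: s_def R'_simps)
      qed
    qed
    have "leads \<beta> X (conf (body @ ?W) ?s (length \<sigma>) x) (H \<beta> (Suc m))"
      using leads_pure[OF a4 in_X(1) leads_pure[OF a5 in_X(1) leads_pure[OF a6 in_X(1) rest]]]
      by (simp add: body_def)
    then have "leads \<beta> X (conf ?W ?s (length \<sigma>) x) (H \<beta> (Suc m))"
      by (intro leads_enter[OF _ in_X(1)]) (simp_all add: s_def R'_def R_def)
    moreover have "H \<beta> m = conf ?W ?s (length \<sigma>) x"
      unfolding H_def tr s_def R_eq by simp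
    ultimately show ?thesis unfolding X by simp
  qed
  \<comment> \<open>The round counter differs, so a round takes at least one step and the times of
    the rounds are unbounded.\<close>
  have distinct: "H \<beta> m \<noteq> H \<beta> (Suc m)" for \<beta> m
  proof
    assume "H \<beta> m = H \<beta> (Suc m)"
    then have "regs (H \<beta> m) 2 = regs (H \<beta> (Suc m)) 2" by simp
    then show False by (simp add: H_def R_def del: trace.simps split: prod.splits)
  qed
  have "H \<beta> 0 = run M \<beta> 1" for \<beta>
    by (auto simp: H_def R_def run_def start_def M_def step_def fun_eq_iff)
  moreover have "io (run M \<beta> 0) = io (H \<beta> 0)" for \<beta>
    by (simp add: run_def start_def io_def H_def)
  moreover have "io (H \<beta> m) = (length (fst (trace K \<beta> m)), snd (trace K \<beta> m))" for \<beta> m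
    by (simp add: H_def io_def split: prod.splits)
  ultimately show ?thesis
    using round distinct by (intro exI[of _ M] allI exI[of _ "H _"]) blast
qed

text \<open>Every moment of the run is either initial or lies within some round, and there the tape
  positions agree with those at one of its two ends.\<close>

lemma run_reaches_rounds:
  assumes H: "H 0 = run M \<beta> 1" "io (run M \<beta> 0) = io (H 0)"
    and step: "\<And>m. H m \<noteq> H (Suc m)" "\<And>m. leads \<beta> {io (H m), io (H (Suc m))} (H m) (H (Suc m))"
  shows "\<exists>t>m. run M \<beta> t = H m \<and> (\<forall>u\<le>t. \<exists>j. io (run M \<beta> u) = io (H j))"
proof (induction m)
  case 0
  show ?case using H by (intro exI[of _ 1]) (auto simp: le_Suc_eq intro: exI[of _ 0])
next
  case (Suc m)
  then obtain t where t: "t > m" "run M \<beta> t = H m" "\<And>u. u \<le> t \<Longrightarrow> \<exists>j. io (run M \<beta> u) = io (H j)"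
    by blast
  obtain v where v: "(step \<beta> ^^ v) (H m) = H (Suc m)"
    "\<And>u. u \<le> v \<Longrightarrow> io ((step \<beta> ^^ u) (H m)) \<in> {io (H m), io (H (Suc m))}"
    using step(2)[of m] unfolding leads_def by blast
  have run_add: "run M \<beta> (t + u) = (step \<beta> ^^ u) (H m)" for u
    unfolding t(2)[symmetric] by (simp add: run_def funpow_add add.commute[of t])
  have "v \<noteq> 0" using v(1) step(1)[of m] by (metis funpow_0)
  have "\<exists>j. io (run M \<beta> u) = io (H j)" if "u \<le> t + v" for u
  proof (cases "u \<le> t")
    case False
    then have "io (run M \<beta> u) \<in> {io (H m), io (H (Suc m))}"
      using v(2)[of "u - t"] run_add[of "u - t"] that by simp
    then show ?thesis by blast
  qed (use t in blast)
  moreover have "run M \<beta> (t + v) = H (Suc m)" using run_add v(1) by simp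
  moreover have "t + v > Suc m" using t(1) \<open>v \<noteq> 0\<close> by simp
  ultimately show ?case by blast
qed

lemma step_io: "written (step \<beta> c) \<noteq> written c \<Longrightarrow> bits_read (step \<beta> c) = bits_read c"
proof (cases "control c")
  case (Cons i p)
  then show "written (step \<beta> c) \<noteq> written c \<Longrightarrow> ?thesis" by (cases i) (auto simp: step_def)
qed (simp add: step_def)

lemma kraft_infsum:
  assumes "(\<lambda>x. 1 / (2 :: real) ^ K x) summable_on UNIV"
    and "(\<Sum>\<^sub>\<infinity>x\<in>UNIV. 1 / (2 :: real) ^ K x) \<le> 1"
  shows "kraft K"
proof
  fix F :: "bool list set" assume "finite F"
  then have "(\<Sum>x\<in>F. 1 / (2 :: real) ^ K x) \<le> (\<Sum>\<^sub>\<infinity>x\<in>UNIV. 1 / (2 :: real) ^ K x)"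
    by (intro finite_sum_le_infsum assms(1)) auto
  with assms(2) show "(\<Sum>x\<in>F. (1/2 :: real) ^ K x) \<le> 1" by (simp add: power_one_over)
qed

theorem theorem1:
  fixes K :: "bool list \<Rightarrow> nat"
  assumes "total_computable K"
    and "(\<lambda>x. 1 / (2 :: real) ^ K x) summable_on UNIV"
    and "(\<Sum>\<^sub>\<infinity>x\<in>UNIV. 1 / (2 :: real) ^ K x) \<le> 1"
  shows "\<exists>M :: machine. \<forall>\<alpha> :: bitseq. \<exists>\<beta> :: bitseq.
    computes M \<beta> \<alpha> \<and> (\<forall>n. oracle_use M \<beta> n \<le> K (\<alpha> \<restriction> n))"
proof -
  interpret kraft K using assms(2,3) by (rule kraft_infsum)
  obtain M where M: "\<And>\<beta>. \<exists>H. H 0 = run M \<beta> 1 \<and> io (run M \<beta> 0) = io (H 0) \<and>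
    (\<forall>m. io (H m) = (length (fst (trace K \<beta> m)), snd (trace K \<beta> m)) \<and>
      H m \<noteq> H (Suc m) \<and> leads \<beta> {io (H m), io (H (Suc m))} (H m) (H (Suc m)))"
    using machine_ex[OF kraft_axioms assms(1)] by metis
  have "\<exists>\<beta>. computes M \<beta> \<alpha> \<and> (\<forall>n. oracle_use M \<beta> n \<le> K (\<alpha> \<restriction> n))" for \<alpha>
  proof -
    obtain \<beta> where reach: "\<And>n. reaches K \<beta> (\<alpha> \<restriction> n)" using oracle_ex by blast
    obtain H where H: "H 0 = run M \<beta> 1" "io (run M \<beta> 0) = io (H 0)"
      and io_H: "\<And>m. io (H m) = (length (fst (trace K \<beta> m)), snd (trace K \<beta> m))"
      and step: "\<And>m. H m \<noteq> H (Suc m)" "\<And>m. leads \<beta> {io (H m), io (H (Suc m))} (H m) (H (Suc m))"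
      using M[of \<beta>] by metis
    note rounds = run_reaches_rounds[OF H step]
    have trace_at: "\<exists>j. bits_read (run M \<beta> t) = length (fst (trace K \<beta> j)) \<and>
        written (run M \<beta> t) = snd (trace K \<beta> j)" for t
    proof -
      obtain u where "u > t" "\<forall>v\<le>u. \<exists>j. io (run M \<beta> v) = io (H j)" using rounds by blast
      then obtain j where "io (run M \<beta> t) = io (H j)" by (meson less_imp_le)
      then show ?thesis using io_H[of j] by (auto simp: io_def)
    qed
    have at_trace: "\<exists>t. written (run M \<beta> t) = snd (trace K \<beta> j)" for j
    proof -
      obtain t where "run M \<beta> t = H j" using rounds by blast
      then show ?thesis using io_H[of j] by (intro exI[of _ t]) (simp add: io_def)
    qed
    have unbounded: "\<exists>t. n \<le> length (written (run M \<beta> t))" for n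
    proof -
      obtain i where "length (snd (trace K \<beta> i)) = n" using trace_unbounded[OF reach] by blast
      then show ?thesis using at_trace[of i] by (metis order_refl)
    qed
    have "written (run M \<beta> t) = \<alpha> \<restriction> length (written (run M \<beta> t))" for t
    proof -
      obtain j where "written (run M \<beta> t) = snd (trace K \<beta> j)" using trace_at by blast
      then show ?thesis
        using trace_correct[OF reach, of j "fst (trace K \<beta> j)" "snd (trace K \<beta> j)"] by simp
    qed
    moreover have "oracle_use M \<beta> n \<le> K (\<alpha> \<restriction> n)" for n
    proof -
      define T where "T = (LEAST t. n \<le> length (written (run M \<beta> t)))"
      have T: "n \<le> length (written (run M \<beta> T))"
        unfolding T_def using unbounded[of n] by (rule LeastI_ex)
      show ?thesis
      \<comment> \<open>At time 0 nothing has been read. Otherwise the preceding moment is decisive: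
        its output is shorter than \<open>n\<close>, so \<open>trace_correct\<close> bounds the bits
        read by then, and the step that writes the bit reads none.\<close>
      proof (cases T)
        case 0
        then have "oracle_use M \<beta> n = bits_read (run M \<beta> 0)" by (simp add: oracle_use_def T_def)
        then show ?thesis by (simp add: run_def start_def)
      next
        case (Suc t)
        then have less: "length (written (run M \<beta> t)) < n"
          unfolding T_def by (metis lessI not_less_Least not_le)
        have run: "run M \<beta> T = step \<beta> (run M \<beta> t)" by (simp add: Suc run_def)
        then have "bits_read (run M \<beta> T) = bits_read (run M \<beta> t)"
          using T less step_io by (metis not_le)
        moreover obtain j where j: "bits_read (run M \<beta> t) = length (fst (trace K \<beta> j))"
          "written (run M \<beta> t) = snd (trace K \<beta> j)" using trace_at by blast
        moreover have "length (fst (trace K \<beta> j)) \<le> K (\<alpha> \<restriction> n)"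
          using trace_correct[OF reach, of j "fst (trace K \<beta> j)" "snd (trace K \<beta> j)"] less j(2) by simp
        ultimately show ?thesis by (simp add: oracle_use_def T_def[symmetric])
      qed
    qed
    ultimately show ?thesis using unbounded unfolding computes_def by blast
  qed
  then show ?thesis by blast
qed

end
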